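(* For online class constrained bin packing with parameter $t=2$, every online algorithm has asymptotic competitive ratio at least $1.717668486$. For $t=3$, every online algorithm has asymptotic competitive ratio at least $1.80814287$.
   Context: In class constrained bin packing with an integer parameter $t\ge 1$, each item has a rational size in $(0,1]$ and a color. Items are packed into bins so that the total size of items in each bin is at most $1$ and each bin contains items of at most $t$ distinct colors; the number of items of any one color in a bin is unrestricted. The cost is the number of bins used. In the online version, items (with their sizes and colors) arrive one by one and each must be irrevocably assigned to a bin before the next item is revealed. Online algorithms are deterministic. For an algorithm $A$ and input $I$, let $A(I)$ be its cost and $OPT(I)$ the minimum possible cost. Let $c(Q)=\max\{A(I): OPT(I)=Q\}$, and define the asymptotic competitive ratio as $R_A=\limsup_{Q\to\infty} c(Q)/Q$. *)

theory Defs
  imports Complex_Main "HOL-Library.Extended_Real"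
begin

text \<open>Colors are natural numbers, so that the supply of colors is unlimited.\<close>

type_synonym color = nat

type_synonym item = "rat \<times> color"

abbreviation item_size :: "item \<Rightarrow> rat" where
  "item_size \<equiv> fst"

abbreviation item_color :: "item \<Rightarrow> color" where
  "item_color \<equiv> snd"

definition valid_input :: "item list \<Rightarrow> bool" where
  "valid_input I \<longleftrightarrow> (\<forall>x \<in> set I. 0 < item_size x \<and> item_size x \<le> 1)"

text \<open>
  A packing maps positions of the input list to (names of) bins, so that equal items occurring
  several times in the input are packed separately. Its values at positions from
  \<open>length I\<close> on are irrelevant.
\<close>

type_synonym packing = "nat \<Rightarrow> nat"

definition bin_content :: "item list \<Rightarrow> packing \<Rightarrow> nat \<Rightarrow> nat set" where
  "bin_content I p b = {i. i < length I \<and> p i = b}"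

definition feasible_packing :: "nat \<Rightarrow> item list \<Rightarrow> packing \<Rightarrow> bool" where
  "feasible_packing t I p \<longleftrightarrow>
     (\<forall>b. (\<Sum>i \<in> bin_content I p b. item_size (I ! i)) \<le> 1 \<and>
          card ((\<lambda>i. item_color (I ! i)) ` bin_content I p b) \<le> t)"

definition bins_used :: "item list \<Rightarrow> packing \<Rightarrow> nat" where
  "bins_used I p = card (p ` {..<length I})"

definition OPT :: "nat \<Rightarrow> item list \<Rightarrow> nat" where
  "OPT t I = (LEAST k. \<exists>p. feasible_packing t I p \<and> bins_used I p = k)"

text \<open>
  A deterministic online algorithm chooses the bin of the current item (second argument) from the
  items that arrived before it (first argument, in order of arrival). Its own earlier decisions
  are determined by the earlier items and hence need not be passed explicitly.
\<close>

type_synonym algorithm = "item list \<Rightarrow> item \<Rightarrow> nat"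

definition online_packing :: "algorithm \<Rightarrow> item list \<Rightarrow> packing" where
  "online_packing A I i = A (take i I) (I ! i)"

definition online_algorithm :: "nat \<Rightarrow> algorithm \<Rightarrow> bool" where
  "online_algorithm t A \<longleftrightarrow>
     (\<forall>I. valid_input I \<longrightarrow> feasible_packing t I (online_packing A I))"

definition cost :: "algorithm \<Rightarrow> item list \<Rightarrow> nat" where
  "cost A I = bins_used I (online_packing A I)"

text \<open>
  The supremum is the maximum whenever the costs for the given value of \<open>OPT\<close> are bounded,
  and \<open>\<infinity>\<close> otherwise.
\<close>

definition worst_cost :: "nat \<Rightarrow> algorithm \<Rightarrow> nat \<Rightarrow> ereal" where
  "worst_cost t A Q = (SUP I \<in> {I. valid_input I \<and> OPT t I = Q}. ereal (real (cost A I)))"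

definition asymptotic_ratio :: "nat \<Rightarrow> algorithm \<Rightarrow> ereal" where
  "asymptotic_ratio t A = limsup (\<lambda>Q. worst_cost t A Q / ereal (real Q))"

end

theory Submission
  imports Defs "HOL-Library.Multiset"
begin

text \<open>
  The adversary starts with tiny items of pairwise distinct colors. The first tiny item of every bin
  is made much larger than every tiny item that is not the first of its bin (online bisection of an exponentially long range of
  sizes), so that an item may fit together with \<open>t\<close> small tiny items but into no existing
  bin. Hence the smalls can be punished by huge items that do not increase the optimum, and this
  bounds the number of bins opened so far. An algorithm that therefore packs many tiny items
  together has many bins that already have \<open>t\<close> colors, and these are useless for items of
  one further color.

  With such a color the adversary plays the bin packing game with items of sizes slightly above
  \<open>1/7\<close>, \<open>1/3\<close> and \<open>1/2\<close>. Every item of size about \<open>1/3\<close> that is not the first one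
  of its kind in its bin is smaller than all the first ones, so the adversary may also end the game
  with items of size about \<open>2/3\<close> that fit with the smaller ones only. All optimal packings consist
  of bins with items of one color that are filled up with \<open>t - 1\<close> tiny items. Tiny items left
  over are packed in groups of \<open>t\<close> together with a huge item of one of their colors, which gives
  additional cost without additional optimal cost.

  For \<open>t = 2\<close> one color suffices. For \<open>t = 3\<close> the adversary may switch to a second color after the
  items of size about \<open>1/7\<close>: bins with two tiny items that received an item of the first color
  are then lost for the algorithm, too. The resulting inequalities between the numbers of bins of
  the various kinds are linear and contradict the assumed ratio.
\<close>

section \<open>Runs of an online algorithm\<close>

text \<open>Each item is paired with its bin. As the algorithm does not see the future, a longer
  input only appends to the run, and \<open>load\<close>, \<open>colors\<close>, \<open>bins\<close>
  and \<open>number\<close> split accordingly.\<close>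

definition run :: "algorithm \<Rightarrow> item list \<Rightarrow> (item \<times> nat) list" where
  "run A I = map (\<lambda>i. (I ! i, online_packing A I i)) [0..<length I]"

definition load :: "(item \<times> nat) list \<Rightarrow> nat \<Rightarrow> rat" where
  "load zs b = sum_list (map (\<lambda>z. item_size (fst z)) (filter (\<lambda>z. snd z = b) zs))"

definition colors :: "(item \<times> nat) list \<Rightarrow> nat \<Rightarrow> color set" where
  "colors zs b = (\<lambda>z. item_color (fst z)) ` {z \<in> set zs. snd z = b}"

definition bins :: "(item \<times> nat) list \<Rightarrow> nat set" where
  "bins zs = snd ` set zs"

definition number :: "(item \<Rightarrow> bool) \<Rightarrow> (item \<times> nat) list \<Rightarrow> nat \<Rightarrow> nat" where
  "number Q zs b = length (filter (\<lambda>z. snd z = b \<and> Q (fst z)) zs)"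

lemma length_run [simp]: "length (run A I) = length I"
  by (simp add: run_def)

lemma run_Nil [simp]: "run A [] = []"
  by (simp add: run_def)

lemma map_fst_run [simp]: "map fst (run A I) = I"
  by (simp add: run_def o_def map_nth)

lemma run_snoc: "run A (I @ [x]) = run A I @ [(x, A I x)]"
  by (rule nth_equalityI) (auto simp: run_def online_packing_def nth_append less_Suc_eq)

lemma take_run: "take (length I) (run A (I @ J)) = run A I"
  by (rule nth_equalityI) (auto simp: run_def online_packing_def nth_append)

lemma run_appendE:
  obtains ws where "run A (I @ J) = run A I @ ws" "map fst ws = J"
proof
  show *: "run A (I @ J) = run A I @ drop (length I) (run A (I @ J))"
    by (metis append_take_drop_id take_run)
  have "map fst (run A I @ drop (length I) (run A (I @ J))) = I @ J"
    by (metis * map_fst_run)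
  then show "map fst (drop (length I) (run A (I @ J))) = J" by simp
qed

lemma load_append: "load (zs @ ws) b = load zs b + load ws b"
  by (simp add: load_def)

lemma load_nonneg: "(\<And>z. z \<in> set zs \<Longrightarrow> 0 \<le> item_size (fst z)) \<Longrightarrow> 0 \<le> load zs b"
  unfolding load_def by (rule sum_list_nonneg) auto

lemma load_ge_member:
  assumes "\<And>z. z \<in> set zs \<Longrightarrow> 0 \<le> item_size (fst z)" "(x, b) \<in> set zs"
  shows "item_size x \<le> load zs b"
proof -
  have "(x, b) \<in> set (filter (\<lambda>z. snd z = b) zs)" using assms(2) by simp
  then have "item_size (fst (x, b)) \<in> set (map (\<lambda>z. item_size (fst z)) (filter (\<lambda>z. snd z = b) zs))"
    unfolding set_map by (rule imageI)
  then have "item_size x \<in> set (map (\<lambda>z. item_size (fst z)) (filter (\<lambda>z. snd z = b) zs))" by simp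
  then show ?thesis unfolding load_def
    by (rule member_le_sum_list) (use assms(1) in \<open>auto\<close>)
qed

lemma load_two:
  assumes "\<And>z. z \<in> set zs \<Longrightarrow> 1 / 2 < item_size (fst z)" "i < j" "j < length zs"
    "snd (zs ! i) = b" "snd (zs ! j) = b"
  shows "1 < load zs b"
proof -
  have "zs = take j zs @ zs ! j # drop (Suc j) zs"
    using assms(3) by (simp add: id_take_nth_drop)
  then have l: "load zs b = load (take j zs) b + load (zs ! j # drop (Suc j) zs) b"
    by (metis load_append)
  have pos: "0 \<le> item_size (fst z)" if "z \<in> set zs" for z
    using assms(1)[OF that] by linarith
  have "item_size (fst (zs ! i)) \<le> load (take j zs) b"
  proof (rule load_ge_member)
    show "0 \<le> item_size (fst z)" if "z \<in> set (take j zs)" for z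
      using that pos by (meson in_set_takeD)
    have "take j zs ! i \<in> set (take j zs)" using assms by (intro nth_mem) simp
    then show "(fst (zs ! i), b) \<in> set (take j zs)" using assms by (metis nth_take prod.collapse)
  qed
  moreover have "item_size (fst (zs ! j)) \<le> load (zs ! j # drop (Suc j) zs) b"
  proof (rule load_ge_member)
    show "0 \<le> item_size (fst z)" if "z \<in> set (zs ! j # drop (Suc j) zs)" for z
    proof -
      have "z \<in> set zs" using that assms(3) by (auto dest: in_set_dropD)
      then show ?thesis by (rule pos)
    qed
    show "(fst (zs ! j), b) \<in> set (zs ! j # drop (Suc j) zs)" using assms(5) by auto
  qed
  moreover have "1 / 2 < item_size (fst (zs ! i))" "1 / 2 < item_size (fst (zs ! j))"
    using assms by auto
  ultimately show ?thesis using l by linarith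
qed

lemma finite_colors [simp]: "finite (colors zs b)"
  by (simp add: colors_def)

lemma finite_bins [simp]: "finite (bins zs)"
  by (simp add: bins_def)

lemma colors_append: "colors (zs @ ws) b = colors zs b \<union> colors ws b"
  by (auto simp: colors_def)

lemma bins_append: "bins (zs @ ws) = bins zs \<union> bins ws"
  by (auto simp: bins_def)

lemma number_append: "number Q (zs @ ws) b = number Q zs b + number Q ws b"
  by (simp add: number_def)

lemma valid_input_append: "valid_input (I @ J) \<longleftrightarrow> valid_input I \<and> valid_input J"
  by (auto simp: valid_input_def)

lemma cost_run: "cost A I = card (bins (run A I))"
  by (simp add: cost_def bins_used_def bins_def run_def image_image atLeast0LessThan)

lemma sum_bin_content_labelled:
  fixes p :: packing
  shows "(\<Sum>i \<in> bin_content I p b. item_size (I ! i)) = load (map (\<lambda>i. (I ! i, p i)) [0..<length I]) b"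
proof -
  have "load (map (\<lambda>i. (I ! i, p i)) [0..<length I]) b
      = sum_list (map (\<lambda>i. item_size (I ! i)) (filter (\<lambda>i. p i = b) [0..<length I]))"
    by (simp add: load_def filter_map o_def)
  also have "\<dots> = (\<Sum>i \<in> set (filter (\<lambda>i. p i = b) [0..<length I]). item_size (I ! i))"
    by (rule sum_list_distinct_conv_sum_set) simp
  also have "set (filter (\<lambda>i. p i = b) [0..<length I]) = bin_content I p b"
    by (auto simp: bin_content_def)
  finally show ?thesis ..
qed

lemma colors_bin_content_labelled:
  "(\<lambda>i. item_color (I ! i)) ` bin_content I p b = colors (map (\<lambda>i. (I ! i, p i)) [0..<length I]) b"
proof -
  have "{z \<in> set (map (\<lambda>i. (I ! i, p i)) [0..<length I]). snd z = b} = (\<lambda>i. (I ! i, p i)) ` bin_content I p b"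
    by (auto simp: bin_content_def)
  then show ?thesis by (simp add: colors_def image_image)
qed

text \<open>Passage from packings by position to lists of items labelled with bins. It serves both
  the online runs and the offline packings that bound the optimum.\<close>

lemma feasible_packing_labelled:
  "feasible_packing t I p \<longleftrightarrow> (\<forall>b. load (map (\<lambda>i. (I ! i, p i)) [0..<length I]) b \<le> 1 \<and>
      card (colors (map (\<lambda>i. (I ! i, p i)) [0..<length I]) b) \<le> t)"
  by (simp add: feasible_packing_def sum_bin_content_labelled colors_bin_content_labelled)

lemma run_feasible:
  assumes "online_algorithm t A" "valid_input I"
  shows "load (run A I) b \<le> 1" "card (colors (run A I) b) \<le> t"
  using assms unfolding online_algorithm_def feasible_packing_labelled run_def by auto

text \<open>A sufficient reason for \<open>b\<close> to refuse \<open>x\<close>, judged by the items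
  present now. It stays valid later because loads and sets of colors only grow.\<close>

definition blocked :: "nat \<Rightarrow> (item \<times> nat) list \<Rightarrow> nat \<Rightarrow> item \<Rightarrow> bool" where
  "blocked t zs b x \<longleftrightarrow> 1 < load zs b + item_size x \<or>
     item_color x \<notin> colors zs b \<and> t \<le> card (colors zs b)"

text \<open>Two items larger than one half never share a bin.\<close>

lemma cost_big_items:
  assumes alg: "online_algorithm t A" and val: "valid_input (I @ W)"
    and big: "\<And>x. x \<in> set W \<Longrightarrow> 1 / 2 < item_size x"
    and Z: "Z \<subseteq> bins (run A I)" and Y: "finite Y"
    and bl: "\<And>x b. x \<in> set W \<Longrightarrow> b \<in> Z - Y \<Longrightarrow> blocked t (run A I) b x"
  shows "card Z + length W \<le> cost A (I @ W) + card Y"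
proof -
  obtain ws where ws: "run A (I @ W) = run A I @ ws" "map fst ws = W"
    by (rule run_appendE)
  have posI: "0 \<le> item_size (fst z)" if "z \<in> set (run A I)" for z
  proof -
    have "fst z \<in> set I" using that by (metis in_set_zipE list.set_map map_fst_run imageI)
    then show ?thesis using val by (force simp: valid_input_def)
  qed
  have bigw: "1 / 2 < item_size (fst z)" if "z \<in> set ws" for z
    using that big ws(2) by (metis imageI list.set_map)
  have posw: "0 \<le> item_size (fst z)" if "z \<in> set ws" for z
    using bigw[OF that] by linarith
  have feas: "load (run A I) b + load ws b \<le> 1" "card (colors (run A I) b \<union> colors ws b) \<le> t" for b
    using run_feasible[OF alg val, of b] by (simp_all add: ws load_append colors_append)
  \<comment> \<open>Every item of \<open>W\<close> has a bin of its own, so \<open>bins ws\<close>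
    has exactly \<open>length W\<close> elements.\<close>
  have "distinct (map snd ws)"
  proof (rule ccontr)
    assume "\<not> distinct (map snd ws)"
    then obtain i j where "i < j" "j < length ws" "snd (ws ! i) = snd (ws ! j)"
      unfolding distinct_conv_nth by (auto simp: nat_neq_iff)
    then have "1 < load ws (snd (ws ! j))" by (intro load_two[where i = i and j = j] bigw) auto
    moreover have "0 \<le> load (run A I) (snd (ws ! j))" by (intro load_nonneg posI)
    ultimately show False using feas(1)[of "snd (ws ! j)"] by linarith
  qed
  then have cw: "card (bins ws) = length W"
    using distinct_card[of "map snd ws"] ws(2) by (auto simp: bins_def)
  have sub: "Z \<inter> bins ws \<subseteq> Y"
  proof
    fix b assume b: "b \<in> Z \<inter> bins ws"
    then obtain x where x: "(x, b) \<in> set ws" by (auto simp: bins_def)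
    have "x \<in> set W" using x ws(2) by force
    show "b \<in> Y"
    proof (rule ccontr)
      assume "b \<notin> Y"
      then have "blocked t (run A I) b x" using bl \<open>x \<in> set W\<close> b by auto
      then show False unfolding blocked_def
      proof
        assume "1 < load (run A I) b + item_size x"
        then show False using load_ge_member[OF posw x] feas(1)[of b] by linarith
      next
        assume *: "item_color x \<notin> colors (run A I) b \<and> t \<le> card (colors (run A I) b)"
        have "insert (item_color x) (colors (run A I) b) \<subseteq> colors (run A I) b \<union> colors ws b"
          using x by (force simp: colors_def)
        then have "card (insert (item_color x) (colors (run A I) b)) \<le> t"
          by (meson card_mono feas(2) finite_Un finite_colors le_trans)
        then show False using * by simp
      qed
    qed
  qed
  have fZ: "finite Z" using Z finite_subset finite_bins by blast
  \<comment> \<open>In counting \<open>Z\<close> together with the bins of \<open>W\<close>, only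
    the exceptional bins in \<open>Y\<close> can be counted twice.\<close>
  have "card Z + length W = card (Z \<union> bins ws) + card (Z \<inter> bins ws)"
    using card_Un_Int[OF fZ finite_bins[of ws]] cw by simp
  also have "card (Z \<inter> bins ws) \<le> card Y" by (rule card_mono[OF Y sub])
  also have "card (Z \<union> bins ws) \<le> cost A (I @ W)"
    unfolding cost_run ws bins_append by (rule card_mono) (use Z in auto)
  finally show ?thesis by simp
qed

section \<open>Packings into bins\<close>

definition bin_ok :: "nat \<Rightarrow> item multiset \<Rightarrow> bool" where
  "bin_ok t B \<longleftrightarrow> (\<Sum>x\<in>#B. item_size x) \<le> 1 \<and> card (item_color ` set_mset B) \<le> t"

text \<open>Offline packings are multisets of bins, free of positions and labels, so that they can
  be combined by addition.\<close>

definition packs :: "nat \<Rightarrow> nat \<Rightarrow> item multiset \<Rightarrow> bool" where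
  "packs t k X \<longleftrightarrow> (\<exists>Bs. size Bs = k \<and> \<Sum>\<^sub># Bs = X \<and> (\<forall>B\<in>#Bs. bin_ok t B))"

lemma packs_add: "packs t k X \<Longrightarrow> packs t l Y \<Longrightarrow> packs t (k + l) (X + Y)"
  unfolding packs_def
proof (elim exE conjE)
  fix Bs Cs
  assume *: "size Bs = k" "\<Sum>\<^sub># Bs = X" "\<forall>B\<in>#Bs. bin_ok t B"
    "size Cs = l" "\<Sum>\<^sub># Cs = Y" "\<forall>B\<in>#Cs. bin_ok t B"
  show "\<exists>Bs. size Bs = k + l \<and> \<Sum>\<^sub># Bs = X + Y \<and> (\<forall>B\<in>#Bs. bin_ok t B)"
    by (rule exI[of _ "Bs + Cs"]) (use * in auto)
qed

lemma labelled_bins: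
  fixes bs :: "item list list"
  defines "ys \<equiv> concat (map (\<lambda>j. map (\<lambda>x. (x, j)) (bs ! j)) [0..<length bs])"
  shows "map fst ys = concat bs" "filter (\<lambda>z. snd z = j) ys = (if j < length bs then map (\<lambda>x. (x, j)) (bs ! j) else [])"
    "snd ` set ys \<subseteq> {..<length bs}"
proof -
  have "map fst ys = concat (map (\<lambda>j. bs ! j) [0..<length bs])"
    by (simp add: ys_def map_concat o_def)
  then show "map fst ys = concat bs" by (simp add: map_nth)
  have "filter (\<lambda>z. snd z = j) (concat (map (\<lambda>j. map (\<lambda>x. (x, j)) (bs ! j)) [0..<n]))
      = (if j < n then map (\<lambda>x. (x, j)) (bs ! j) else [])" for n
    by (induction n) (auto simp: filter_map o_def less_Suc_eq)
  then show "filter (\<lambda>z. snd z = j) ys = (if j < length bs then map (\<lambda>x. (x, j)) (bs ! j) else [])"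
    unfolding ys_def .
  show "snd ` set ys \<subseteq> {..<length bs}" by (auto simp: ys_def)
qed

text \<open>The bins are listed one after the other with labels; since this list is a permutation of
  the input, the labels can be carried back to the positions of the input.\<close>

lemma OPT_le:
  assumes "packs t k (mset I)"
  shows "OPT t I \<le> k"
proof -
  obtain Bs where Bs: "size Bs = k" "\<Sum>\<^sub># Bs = mset I" "\<forall>B\<in>#Bs. bin_ok t B"
    using assms by (auto simp: packs_def)
  obtain ms where ms: "mset ms = Bs" by (rule exE[OF ex_mset])
  define bs where "bs = map (\<lambda>B. SOME l. mset l = B) ms"
  have some: "mset (SOME l. mset l = B) = B" for B :: "item multiset"
    by (rule someI_ex[OF ex_mset])
  have bs: "length bs = k" "mset (concat bs) = mset I" "\<forall>b\<in>set bs. bin_ok t (mset b)"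
  proof -
    show "length bs = k" using Bs(1) ms by (auto simp: bs_def)
    have "map mset bs = ms" by (simp add: bs_def some o_def)
    then show "mset (concat bs) = mset I" using Bs(2) ms
      by (metis mset_concat sum_mset_sum_list)
    show "\<forall>b\<in>set bs. bin_ok t (mset b)" using Bs(3) ms by (auto simp: bs_def some)
  qed
  define ys where "ys = concat (map (\<lambda>j. map (\<lambda>x. (x, j)) (bs ! j)) [0..<length bs])"
  have ys: "map fst ys = concat bs"
    "\<And>j. filter (\<lambda>z. snd z = j) ys = (if j < length bs then map (\<lambda>x. (x, j)) (bs ! j) else [])"
    "snd ` set ys \<subseteq> {..<length bs}"
    using labelled_bins[where bs = bs] unfolding ys_def by blast+
  have "mset I = mset (map fst ys)" using ys(1) bs(2) by simp
  moreover have "length (map fst ys) = length (map snd ys)" by simp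
  ultimately obtain cs where cs: "length I = length cs" "mset (zip I cs) = mset (zip (map fst ys) (map snd ys))"
    using ex_mset_zip_left[of "map fst ys" "map snd ys" I] by metis
  have zs: "mset (zip I cs) = mset ys" using cs(2) by (simp add: zip_map_fst_snd)
  define p where "p i = cs ! i" for i
  have lab: "map (\<lambda>i. (I ! i, p i)) [0..<length I] = zip I cs"
    by (rule nth_equalityI) (use cs(1) in \<open>auto simp: p_def\<close>)
  have "load (zip I cs) b \<le> 1 \<and> card (colors (zip I cs) b) \<le> t" for b
  proof -
    have "load (zip I cs) b = load ys b"
      unfolding load_def sum_mset_sum_list[symmetric] mset_map mset_filter zs ..
    also have "\<dots> = (if b < length bs then sum_list (map item_size (bs ! b)) else 0)"
      by (simp add: load_def ys(2) o_def)
    also have "\<dots> \<le> 1"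
      using bs(3) by (auto simp: bin_ok_def simp flip: sum_mset_sum_list dest: nth_mem)
    finally have 1: "load (zip I cs) b \<le> 1" .
    have "{z \<in> set (zip I cs). snd z = b} = set (filter (\<lambda>z. snd z = b) ys)"
      using mset_eq_setD[OF zs] by auto
    then have "colors (zip I cs) b = (if b < length bs then item_color ` set (bs ! b) else {})"
      unfolding colors_def ys(2) by (auto simp: image_image)
    then have "card (colors (zip I cs) b) \<le> t"
      using bs(3) by (auto simp: bin_ok_def dest: nth_mem)
    with 1 show ?thesis by simp
  qed
  then have feas: "feasible_packing t I p"
    unfolding feasible_packing_labelled lab by blast
  have "p ` {..<length I} = snd ` set (zip I cs)"
    unfolding lab[symmetric] by (simp add: image_image atLeast0LessThan)
  also have "\<dots> = snd ` set ys" using mset_eq_setD[OF zs] by simp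
  finally have "bins_used I p \<le> card {..<length bs}"
    unfolding bins_used_def using ys(3) by (metis card_mono finite_lessThan)
  then have "bins_used I p \<le> k" using bs(1) by simp
  moreover have "OPT t I \<le> bins_used I p"
    unfolding OPT_def by (rule Least_le) (use feas in blast)
  ultimately show ?thesis by simp
qed

text \<open>No bin has more than \<open>t\<close> colors. Inputs with many colors thus have a large
  optimum, which is where a bound on the limit superior takes effect.\<close>

lemma OPT_ge_colors:
  assumes "valid_input I" "1 \<le> t"
  shows "card (item_color ` set I) \<le> t * OPT t I"
proof -
  \<comment> \<open>One bin per item is feasible, so the \<open>LEAST\<close> in \<open>OPT\<close>
    is attained.\<close>
  have "\<exists>k p. feasible_packing t I p \<and> bins_used I p = k"
  proof (intro exI conjI)
    have bc: "bin_content I (\<lambda>i. i) b = (if b < length I then {b} else {})" for b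
      by (auto simp: bin_content_def)
    show "feasible_packing t I (\<lambda>i. i)"
      using assms unfolding feasible_packing_def bc by (auto simp: valid_input_def)
  qed (rule refl)
  then obtain p where p: "feasible_packing t I p" "bins_used I p = OPT t I"
    unfolding OPT_def by (smt (verit) LeastI_ex)
  have "item_color ` set I = (\<Union>b \<in> p ` {..<length I}. (\<lambda>i. item_color (I ! i)) ` bin_content I p b)"
    by (auto simp: bin_content_def set_conv_nth image_iff) blast+
  also have "card \<dots> \<le> (\<Sum>b \<in> p ` {..<length I}. card ((\<lambda>i. item_color (I ! i)) ` bin_content I p b))"
    by (rule card_UN_le) simp
  also have "\<dots> \<le> (\<Sum>b \<in> p ` {..<length I}. t)"
    by (rule sum_mono) (use p(1) in \<open>auto simp: feasible_packing_def\<close>)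
  also have "\<dots> = t * OPT t I" using p(2) by (simp add: bins_used_def)
  finally show ?thesis .
qed

text \<open>Bins of a single color with free space \<epsilon>. For
  \<open>\<epsilon> = of_nat (t - 1) * \<eta>\<close> each of them can still take
  \<open>t - 1\<close> tiny items of arbitrary colors.\<close>

definition base_packs :: "rat \<Rightarrow> nat \<Rightarrow> item multiset \<Rightarrow> bool" where
  "base_packs \<epsilon> k X \<longleftrightarrow> (\<exists>Bs. size Bs = k \<and> \<Sum>\<^sub># Bs = X \<and>
     (\<forall>B\<in>#Bs. (\<Sum>x\<in>#B. item_size x) \<le> 1 - \<epsilon> \<and> (\<exists>c. item_color ` set_mset B \<subseteq> {c})))"

lemma base_packs_add:
  assumes "base_packs \<epsilon> k X" "base_packs \<epsilon> l Y"
  shows "base_packs \<epsilon> (k + l) (X + Y)"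
proof -
  obtain Bs Cs where *: "size Bs = k" "\<Sum>\<^sub># Bs = X"
    "\<forall>B\<in>#Bs. (\<Sum>x\<in>#B. item_size x) \<le> 1 - \<epsilon> \<and> (\<exists>c. item_color ` set_mset B \<subseteq> {c})"
    "size Cs = l" "\<Sum>\<^sub># Cs = Y"
    "\<forall>B\<in>#Cs. (\<Sum>x\<in>#B. item_size x) \<le> 1 - \<epsilon> \<and> (\<exists>c. item_color ` set_mset B \<subseteq> {c})"
    using assms unfolding base_packs_def by metis
  show ?thesis unfolding base_packs_def
    by (rule exI[of _ "Bs + Cs"]) (use * in auto)
qed

lemma base_packs_0 [simp]: "base_packs \<epsilon> 0 {#}"
  by (auto simp: base_packs_def)

text \<open>Units of size at most \<open>s\<close> are grouped \<open>k\<close> at a time; the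
  quotient is the number of groups, rounded up.\<close>

lemma base_packs_units:
  assumes "1 \<le> k" "\<And>U x. U \<in> set us \<Longrightarrow> x \<in># U \<Longrightarrow> item_color x = c"
    "\<And>U. U \<in> set us \<Longrightarrow> (\<Sum>x\<in>#U. item_size x) \<le> s" "of_nat k * s \<le> 1 - \<epsilon>" "0 \<le> s"
  shows "base_packs \<epsilon> ((length us + k - 1) div k) (sum_list us)"
  using assms(2,3)
proof (induction us rule: length_induct)
  case (1 us)
  show ?case
  proof (cases "us = []")
    case True
    then show ?thesis using assms(1) by (simp add: div_less)
  next
    case False
    define vs ws where "vs = take k us" and "ws = drop k us"
    have us: "us = vs @ ws" by (simp add: vs_def ws_def)
    have sub: "set vs \<subseteq> set us" "set ws \<subseteq> set us"
      by (auto simp: vs_def ws_def dest: in_set_takeD in_set_dropD)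
    have lw: "length ws = length us - k" by (simp add: ws_def)
    have "base_packs \<epsilon> ((length ws + k - 1) div k) (sum_list ws)"
    proof (rule "1.IH"[rule_format])
      show "length ws < length us" using False assms(1) lw by (cases us) auto
    qed (use "1.prems" sub in auto)
    moreover have "base_packs \<epsilon> 1 (sum_list vs)"
    proof -
      have sz: "(\<Sum>x\<in>#sum_list l. item_size x) \<le> of_nat (length l) * s" if "set l \<subseteq> set us" for l
        using that
      proof (induction l)
        case (Cons U l)
        then have "(\<Sum>x\<in>#sum_list l. item_size x) \<le> of_nat (length l) * s" "(\<Sum>x\<in>#U. item_size x) \<le> s"
          using "1.prems"(2) by auto
        then show ?case by (simp add: algebra_simps)
      qed simp
      have "(\<Sum>x\<in>#sum_list vs. item_size x) \<le> of_nat (length vs) * s" by (rule sz[OF sub(1)])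
      also have "\<dots> \<le> of_nat k * s"
        by (rule mult_right_mono) (use assms(5) in \<open>auto simp: vs_def\<close>)
      finally have "(\<Sum>x\<in>#sum_list vs. item_size x) \<le> 1 - \<epsilon>" using assms(4) by linarith
      moreover have "item_color ` set_mset (sum_list vs) \<subseteq> {c}"
        using sub(1) "1.prems"(1) by (auto simp: set_mset_sum_list)
      ultimately show ?thesis unfolding base_packs_def
        by (intro exI[of _ "{#sum_list vs#}"]) auto
    qed
    ultimately have "base_packs \<epsilon> (1 + (length ws + k - 1) div k) (sum_list us)"
      unfolding us using base_packs_add by fastforce
    \<comment> \<open>Removing a group lowers the rounded-up quotient by one, also if the group is
      the last and incomplete one.\<close>
    moreover have "1 + (length ws + k - 1) div k = (length us + k - 1) div k"
    proof (cases "k \<le> length us")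
      case True
      then have "length us + k - 1 = (length ws + k - 1) + k" using lw assms(1) by simp
      then have "(length us + k - 1) div k = (length ws + k - 1 + k) div k" by simp
      also have "\<dots> = 1 + (length ws + k - 1) div k" using assms(1) by (subst div_add_self2) auto
      finally show ?thesis ..
    next
      case F: False
      moreover have "1 \<le> length us" using False by (simp add: Suc_le_eq)
      ultimately have "(length us + k - 1) div k = Suc ((length us - 1) div k)"
        using assms(1) by (metis Nat.add_diff_assoc2 One_nat_def add.commute div_add_self1 not_one_le_zero plus_1_eq_Suc)
      then show ?thesis using F lw assms(1) by (simp add: div_less)
    qed
    ultimately show ?thesis by simp
  qed
qed

lemma mset_take_size:
  assumes "n \<le> size X"
  obtains Y where "Y \<subseteq># X" "size Y = n"
proof -
  obtain xs where "mset xs = X" by (rule exE[OF ex_mset])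
  then show thesis using assms
    by (intro that[of "mset (take n xs)"]) (metis append_take_drop_id mset_append mset_subset_eq_add_left, auto)
qed

text \<open>Each bin in turn takes \<open>t - 1\<close> items of \<open>Y\<close> while there are
  any. They just use up its free space and add at most \<open>t - 1\<close> colors to the one
  present.\<close>

lemma packs_fill:
  assumes base: "base_packs (of_nat (t - 1) * \<eta>) k X" and t: "1 \<le> t" and \<eta>: "0 \<le> \<eta>"
    and Y: "\<And>x. x \<in># Y \<Longrightarrow> item_size x \<le> \<eta>" "size Y \<le> (t - 1) * k"
  shows "packs t k (X + Y)"
proof -
  obtain Bs where Bs: "size Bs = k" "\<Sum>\<^sub># Bs = X"
    "\<forall>B\<in>#Bs. (\<Sum>x\<in>#B. item_size x) \<le> 1 - of_nat (t - 1) * \<eta> \<and> (\<exists>c. item_color ` set_mset B \<subseteq> {c})"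
    using base unfolding base_packs_def by blast
  from Bs Y show ?thesis
  proof (induction Bs arbitrary: k X Y)
    case empty
    then show ?case by (auto simp: packs_def intro!: exI[of _ "{#}"])
  next
    case (add B Bs)
    obtain Y1 where Y1: "Y1 \<subseteq># Y" "size Y1 = min (t - 1) (size Y)"
      by (rule mset_take_size[of "min (t - 1) (size Y)" Y]) auto
    have "packs t (size Bs) (\<Sum>\<^sub># Bs + (Y - Y1))"
    proof (rule add.IH)
      show "item_size x \<le> \<eta>" if "x \<in># Y - Y1" for x
        using that add.prems(4) by (meson in_diffD)
      have "size Y \<le> (t - 1) * size Bs + (t - 1)" using add.prems(1,5) by auto
      then show "size (Y - Y1) \<le> (t - 1) * size Bs"
        using Y1 by (auto simp: size_Diff_submset)
    qed (use add.prems in auto)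
    moreover have "packs t 1 (B + Y1)"
    proof -
      have s1: "(\<Sum>x\<in>#Y1. item_size x) \<le> of_nat (t - 1) * \<eta>"
      proof -
        have "(\<Sum>x\<in>#Y1. item_size x) \<le> (\<Sum>x\<in>#Y1. \<eta>)"
          by (rule sum_mset_mono) (use add.prems(4) Y1(1) in \<open>meson mset_subset_eqD\<close>)
        also have "\<dots> = of_nat (size Y1) * \<eta>" by (simp add: sum_mset_constant)
        also have "\<dots> \<le> of_nat (t - 1) * \<eta>" by (rule mult_right_mono) (use Y1 \<eta> in auto)
        finally show ?thesis .
      qed
      obtain c where c: "item_color ` set_mset B \<subseteq> {c}" using add.prems(3) by auto
      have "card (item_color ` set_mset (B + Y1)) \<le> card (insert c (item_color ` set_mset Y1))"
        by (rule card_mono) (use c in auto)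
      also have "\<dots> \<le> Suc (card (item_color ` set_mset Y1))" by (rule card_insert_le_m1[THEN order.trans]) auto
      also have "card (item_color ` set_mset Y1) \<le> size Y1"
        by (metis card_image_le card_length ex_mset finite_set_mset le_trans set_mset_mset size_mset)
      finally have "card (item_color ` set_mset (B + Y1)) \<le> t" using Y1 t by simp
      then have "bin_ok t (B + Y1)"
        unfolding bin_ok_def using s1 add.prems(3) by auto
      then show ?thesis unfolding packs_def by (intro exI[of _ "{#B + Y1#}"]) auto
    qed
    ultimately have "packs t (1 + size Bs) ((B + Y1) + (\<Sum>\<^sub># Bs + (Y - Y1)))"
      by (intro packs_add)
    moreover have "(B + Y1) + (\<Sum>\<^sub># Bs + (Y - Y1)) = X + Y"
    proof -
      obtain Y2 where "Y = Y1 + Y2" using Y1(1) by (auto simp: mset_subset_eq_exists_conv)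
      then show ?thesis using add.prems(2) by (auto simp: ac_simps)
    qed
    ultimately show ?case using add.prems(1) by simp
  qed
qed

lemma base_packs_map:
  assumes "\<And>x. x \<in> set xs \<Longrightarrow> (\<Sum>y\<in>#F x. item_size y) \<le> 1 - \<epsilon>"
    "\<And>x. x \<in> set xs \<Longrightarrow> \<exists>c. item_color ` set_mset (F x) \<subseteq> {c}"
  shows "base_packs \<epsilon> (length xs) (sum_list (map F xs))"
  unfolding base_packs_def
proof (intro exI[of _ "mset (map F xs)"] conjI)
  show "\<Sum>\<^sub># (mset (map F xs)) = sum_list (map F xs)" by (rule sum_mset_sum_list)
qed (use assms in auto)

text \<open>Besides the \<open>b\<close> bins for \<open>X\<close>, up to \<open>q\<close> bins are
  started with one item of \<open>Y\<close> each. If that item is in \<open>os\<close>, a huge item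
  of its color joins it. All these bins have one color and room for \<open>t - 1\<close> further
  items of \<open>Y\<close>, so the bound is independent of how many huge items there are.\<close>

lemma packs_huge:
  assumes base: "base_packs (of_nat (t - 1) * \<eta>) b X" and t: "1 \<le> t"
    and \<eta>: "0 \<le> \<eta>" "of_nat t * \<eta> \<le> 1"
    and tiny: "\<And>x. x \<in># Y \<Longrightarrow> item_size x \<le> \<eta>"
    and os: "mset os \<subseteq># Y" "length os \<le> q" and cap: "size Y \<le> (t - 1) * b + t * q"
  shows "\<exists>k \<le> b + q. packs t k (Y + X + mset (map (\<lambda>x. (1 - of_nat t * \<eta>, item_color x)) os))"
proof -
  \<comment> \<open>If \<open>Y\<close> has fewer than \<open>q\<close> items, only as many bins can
    be started.\<close>
  define q' where "q' = min q (size Y)"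
  have los: "length os \<le> size Y" using size_mset_mono[OF os(1)] by simp
  have t\<eta>: "of_nat t * \<eta> = of_nat (t - 1) * \<eta> + \<eta>" using t by (cases t) (auto simp: algebra_simps)
  have tosm: "item_size x \<le> \<eta>" if "x \<in> set os" for x
    using that os(1) tiny by (meson mset_subset_eqD set_mset_mset in_multiset_in_set)
  obtain Y1 where Y1: "Y1 \<subseteq># Y - mset os" "size Y1 = q' - length os"
    by (rule mset_take_size[of "q' - length os" "Y - mset os"])
      (use los os in \<open>auto simp: q'_def size_Diff_submset\<close>)
  obtain ys where ys: "mset ys = Y1" by (rule exE[OF ex_mset])
  obtain Y2 where Yeq: "Y = mset os + Y1 + Y2"
  proof -
    obtain Y0 where "Y = mset os + Y0" using os(1) by (auto simp: mset_subset_eq_exists_conv)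
    moreover from this obtain Y2 where "Y0 = Y1 + Y2" using Y1(1) by (auto simp: mset_subset_eq_exists_conv)
    ultimately show ?thesis by (intro that[of Y2]) (simp add: add.assoc)
  qed
  have "base_packs (of_nat (t - 1) * \<eta>) (length os)
      (sum_list (map (\<lambda>x. {#x, (1 - of_nat t * \<eta>, item_color x)#}) os))"
  proof (rule base_packs_map)
    fix x assume "x \<in> set os"
    then show "(\<Sum>y\<in>#{#x, (1 - of_nat t * \<eta>, item_color x)#}. item_size y) \<le> 1 - of_nat (t - 1) * \<eta>"
      using tosm[of x] t\<eta> by simp
  qed auto
  moreover have "sum_list (map (\<lambda>x. {#x, g x#}) os) = mset os + mset (map g os)" for g :: "item \<Rightarrow> item" and os
    by (induction os) auto
  ultimately have 1: "base_packs (of_nat (t - 1) * \<eta>) (length os)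
      (mset os + mset (map (\<lambda>x. (1 - of_nat t * \<eta>, item_color x)) os))" by simp
  have "base_packs (of_nat (t - 1) * \<eta>) (length ys) (sum_list (map (\<lambda>x. {#x#}) ys))"
  proof (rule base_packs_map)
    fix x assume "x \<in> set ys"
    then have "item_size x \<le> \<eta>" using ys Yeq tiny[of x] by auto
    then show "(\<Sum>y\<in>#{#x#}. item_size y) \<le> 1 - of_nat (t - 1) * \<eta>" using \<eta>(2) t\<eta> by simp
  qed auto
  moreover have "sum_list (map (\<lambda>x. {#x#}) ys) = mset ys" by (induction ys) auto
  ultimately have 2: "base_packs (of_nat (t - 1) * \<eta>) (length ys) Y1" using ys by simp
  have "packs t (b + length os + length ys)
      ((X + (mset os + mset (map (\<lambda>x. (1 - of_nat t * \<eta>, item_color x)) os)) + Y1) + Y2)"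
  proof (rule packs_fill[OF _ t \<eta>(1)])
    show "base_packs (of_nat (t - 1) * \<eta>) (b + length os + length ys)
       (X + (mset os + mset (map (\<lambda>x. (1 - of_nat t * \<eta>, item_color x)) os)) + Y1)"
      by (intro base_packs_add base 1 2)
    show "item_size x \<le> \<eta>" if "x \<in># Y2" for x using that tiny Yeq by auto
    have ly: "length ys = q' - length os" using ys Y1(2) by (metis size_mset)
    have "size Y = length os + (q' - length os) + size Y2" using Yeq Y1(2) by simp
    then have "size Y2 = size Y - q'" using los os(2) by (auto simp: q'_def)
    moreover have "size Y - q' \<le> (t - 1) * (b + q')"
    proof (cases "q \<le> size Y")
      case True
      obtain u where "t = Suc u" using t by (cases t) auto
      then show ?thesis using True cap by (simp add: q'_def algebra_simps)
    qed (simp add: q'_def)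
    moreover have "b + length os + length ys = b + q'"
      using ly los os(2) by (auto simp: q'_def)
    ultimately show "size Y2 \<le> (t - 1) * (b + length os + length ys)" by (simp only:)
  qed
  moreover have "b + length os + length ys \<le> b + q"
  proof -
    have "length ys = q' - length os" using ys Y1(2) by (metis size_mset)
    then show ?thesis using os(2) by (auto simp: q'_def)
  qed
  ultimately show ?thesis
    by (intro exI[of _ "b + length os + length ys"]) (auto simp: Yeq ac_simps)
qed

section \<open>Adaptive sizes\<close>

text \<open>
  The codes offered lie in a gap of length \<open>2 ^ (n - k)\<close> above \<open>L\<close>, which is bisected in every step: the
  items \<open>Ls\<close> that are first in their bins get codes up to \<open>L\<close>, the others (\<open>Ss\<close>) get codes above the
  gap.
\<close>

lemma adaptive_sizes:
  fixes f :: "nat \<Rightarrow> nat \<Rightarrow> item"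
  assumes "k \<le> n"
  shows "\<exists>ws Ls Ss L. run A (I @ map fst ws) = run A I @ ws \<and> length ws = k \<and>
    (\<forall>i<k. \<exists>c \<le> 2 ^ n. fst (ws ! i) = f i c) \<and>
    mset (map fst ws) = mset Ls + mset Ss \<and> length Ls = card (bins ws) \<and>
    (\<forall>b \<in> bins ws. \<exists>x \<in> set Ls. (x, b) \<in> set ws) \<and> L + 2 ^ (n - k) \<le> 2 ^ n \<and>
    (\<forall>x \<in> set Ls. \<exists>i<k. \<exists>c \<le> L. x = f i c) \<and>
    (\<forall>x \<in> set Ss. \<exists>i<k. \<exists>c \<le> 2 ^ n. L + 2 ^ (n - k) \<le> c \<and> x = f i c)"
  using assms
proof (induction k)
  case 0
  then show ?case
    by (intro exI[of _ "[]"] exI[of _ 0]) (auto simp: bins_def)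
next
  case (Suc k)
  then obtain ws Ls Ss L where IH: "run A (I @ map fst ws) = run A I @ ws" "length ws = k"
    "\<forall>i<k. \<exists>c \<le> 2 ^ n. fst (ws ! i) = f i c"
    "mset (map fst ws) = mset Ls + mset Ss" "length Ls = card (bins ws)"
    "\<forall>b \<in> bins ws. \<exists>x \<in> set Ls. (x, b) \<in> set ws" "L + 2 ^ (n - k) \<le> 2 ^ n"
    "\<forall>x \<in> set Ls. \<exists>i<k. \<exists>c \<le> L. x = f i c"
    "\<forall>x \<in> set Ss. \<exists>i<k. \<exists>c \<le> 2 ^ n. L + 2 ^ (n - k) \<le> c \<and> x = f i c"
    by auto
  define h :: nat where "h = 2 ^ (n - Suc k)"
  have h: "2 ^ (n - k) = h + h" "0 < h"
    using Suc.prems by (auto simp: h_def Suc_diff_Suc simp flip: power_Suc mult_2)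
  \<comment> \<open>The midpoint of the gap, fixed before the algorithm decides. If the item joins a
    bin of \<open>ws\<close>, it counts as small and the lower half of the gap remains; otherwise it
    is first in its bin and the upper half remains.\<close>
  define c where "c = L + h"
  define x where "x = f k c"
  define b where "b = A (I @ map fst ws) x"
  define ws' where "ws' = ws @ [(x, b)]"
  have c: "c \<le> 2 ^ n" using IH(7) h by (simp add: c_def)
  have 1: "run A (I @ map fst ws') = run A I @ ws'"
    using run_snoc[of A "I @ map fst ws" x] IH(1) by (simp add: ws'_def b_def)
  have 2: "\<forall>i<Suc k. \<exists>c \<le> 2 ^ n. fst (ws' ! i) = f i c"
  proof (intro allI impI)
    fix i assume i: "i < Suc k"
    show "\<exists>c \<le> 2 ^ n. fst (ws' ! i) = f i c"
    proof (cases "i = k")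
      case True
      then have "fst (ws' ! i) = f i c" using IH(2) nth_append_length[of ws "(x, b)" "[]"]
        by (simp add: ws'_def x_def)
      then show ?thesis using c by blast
    next
      case False
      then have "i < k" using i by simp
      then show ?thesis using IH(3) IH(2) by (simp add: ws'_def nth_append)
    qed
  qed
  have 3: "length ws' = Suc k" using IH(2) by (simp add: ws'_def)
  have in_ws': "\<exists>y \<in> set Ls'. (y, d) \<in> set ws'"
    if "d \<in> bins ws" "set Ls \<subseteq> set Ls'" for d Ls'
    using IH(6) that by (metis Un_iff set_append subset_code(1) ws'_def)
  have bins: "bins ws' = insert b (bins ws)" by (auto simp: ws'_def bins_def)
  have large: "\<exists>i<Suc k. \<exists>d\<le>C. y = f i d" if "i \<le> k" "d \<le> C" "y = f i d" for i d C y
    using that le_imp_less_Suc by blast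
  have small: "\<exists>i<Suc k. \<exists>d\<le>2 ^ n. D \<le> d \<and> y = f i d" if "i \<le> k" "d \<le> 2 ^ n" "D \<le> d" "y = f i d" for i d D y
    using that le_imp_less_Suc by blast
  show ?case
  proof (cases "b \<in> bins ws")
    case True
    show ?thesis
    proof (rule exI[of _ ws'], rule exI[of _ Ls], rule exI[of _ "x # Ss"], rule exI[of _ L], intro conjI)
      show "mset (map fst ws') = mset Ls + mset (x # Ss)" using IH(4) by (simp add: ws'_def)
      show "length Ls = card (bins ws')" using IH(5) True bins by (simp add: insert_absorb)
      show "\<forall>b\<in>bins ws'. \<exists>x\<in>set Ls. (x, b) \<in> set ws'"
        using True bins in_ws' by (metis insertE order_refl)
      show "L + 2 ^ (n - Suc k) \<le> 2 ^ n" using IH(7) h by (simp flip: h_def)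
      show "\<forall>y\<in>set Ls. \<exists>i<Suc k. \<exists>c\<le>L. y = f i c" 
      proof
        fix y assume "y \<in> set Ls"
        then obtain i d where "i < k" "d \<le> L" "y = f i d" using IH(8) by blast
        then show "\<exists>i<Suc k. \<exists>c\<le>L. y = f i c" by (intro large[of i d]) simp_all
      qed
      show "\<forall>y\<in>set (x # Ss). \<exists>i<Suc k. \<exists>c\<le>2 ^ n. L + 2 ^ (n - Suc k) \<le> c \<and> y = f i c"
      proof
        fix y assume "y \<in> set (x # Ss)"
        then consider "y = x" | "y \<in> set Ss" by auto
        then show "\<exists>i<Suc k. \<exists>c\<le>2 ^ n. L + 2 ^ (n - Suc k) \<le> c \<and> y = f i c"
        proof cases
          case 1
          then show ?thesis using c by (intro small[of k c]) (simp_all add: c_def x_def h_def)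
        next
          case 2
          then obtain i d where "i < k" "d \<le> 2 ^ n" "L + 2 ^ (n - k) \<le> d" "y = f i d"
            using IH(9) by blast
          then show ?thesis using h by (intro small[of i d]) (simp_all flip: h_def)
        qed
      qed
    qed (rule 1 2 3)+
  next
    case False
    show ?thesis
    proof (rule exI[of _ ws'], rule exI[of _ "x # Ls"], rule exI[of _ Ss], rule exI[of _ c], intro conjI)
      show "mset (map fst ws') = mset (x # Ls) + mset Ss" using IH(4) by (simp add: ws'_def)
      show "length (x # Ls) = card (bins ws')" using IH(5) False bins by simp
      show "\<forall>b\<in>bins ws'. \<exists>x\<in>set (x # Ls). (x, b) \<in> set ws'"
      proof
        fix d assume "d \<in> bins ws'"
        then consider "d = b" | "d \<in> bins ws" using bins by auto
        then show "\<exists>y\<in>set (x # Ls). (y, d) \<in> set ws'"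
        proof cases
          case 1
          then show ?thesis by (simp add: ws'_def)
        next
          case 2
          then show ?thesis using in_ws'[of d "x # Ls"] by auto
        qed
      qed
      show "c + 2 ^ (n - Suc k) \<le> 2 ^ n" using IH(7) h by (simp add: c_def flip: h_def)
      show "\<forall>y\<in>set (x # Ls). \<exists>i<Suc k. \<exists>d\<le>c. y = f i d"
      proof
        fix y assume "y \<in> set (x # Ls)"
        then consider "y = x" | "y \<in> set Ls" by auto
        then show "\<exists>i<Suc k. \<exists>d\<le>c. y = f i d"
        proof cases
          case 1
          then show ?thesis by (intro large[of k c]) (simp_all add: x_def)
        next
          case 2
          then obtain i d where "i < k" "d \<le> L" "y = f i d" using IH(8) by blast
          then show ?thesis by (intro large[of i d]) (simp_all add: c_def)
        qed
      qed
      show "\<forall>y\<in>set Ss. \<exists>i<Suc k. \<exists>d\<le>2 ^ n. c + 2 ^ (n - Suc k) \<le> d \<and> y = f i d"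
      proof
        fix y assume "y \<in> set Ss"
        then obtain i d where "i < k" "d \<le> 2 ^ n" "L + 2 ^ (n - k) \<le> d" "y = f i d"
          using IH(9) by blast
        then show "\<exists>i<Suc k. \<exists>d\<le>2 ^ n. c + 2 ^ (n - Suc k) \<le> d \<and> y = f i d"
          using h by (intro small[of i d]) (simp_all add: c_def flip: h_def)
      qed
    qed (rule 1 2 3)+
  qed
qed

text \<open>
  All sizes exceed \<open>1/7\<close>, \<open>1/3\<close> and \<open>1/2\<close> by at least \<open>1/1000\<close>, but one item of each size and two tiny
  items still fit together, since \<open>1/7 + 1/3 + 1/2 = 41/42\<close>.
\<close>

abbreviation sizeA :: rat where "sizeA \<equiv> 1007 / 7000"
abbreviation sizeC :: rat where "sizeC \<equiv> 501 / 1000"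

definition isA :: "item \<Rightarrow> bool" where "isA x \<longleftrightarrow> item_size x = sizeA"
definition isB :: "item \<Rightarrow> bool" where "isB x \<longleftrightarrow> 1003 / 3000 \<le> item_size x"

text \<open>No item is counted twice, since \<open>sizeA\<close> lies below the threshold in
  \<open>isB\<close>.\<close>

lemma load_ge_numbers:
  assumes "\<And>z. z \<in> set zs \<Longrightarrow> 0 \<le> item_size (fst z)"
  shows "sizeA * of_nat (number isA zs b) + (1003 / 3000) * of_nat (number isB zs b) \<le> load zs b"
  using assms
proof (induction zs)
  case Nil
  then show ?case by (simp add: number_def load_def)
next
  case (Cons z zs)
  have IH: "sizeA * of_nat (number isA zs b) + (1003 / 3000) * of_nat (number isB zs b) \<le> load zs b"
    using Cons by simp
  have z: "0 \<le> item_size (fst z)" using Cons.prems by simp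
  have n: "number Q (z # zs) b = (if snd z = b \<and> Q (fst z) then 1 else 0) + number Q zs b" for Q
    by (simp add: number_def)
  have l: "load (z # zs) b = (if snd z = b then item_size (fst z) else 0) + load zs b"
    by (simp add: load_def)
  have "\<not> (isA (fst z) \<and> isB (fst z))" by (auto simp: isA_def isB_def)
  then show ?case unfolding n l using IH z
    by (auto simp: isA_def isB_def algebra_simps)
qed

lemma sum_number:
  assumes "finite S" "\<And>z. z \<in> set zs \<Longrightarrow> Q (fst z) \<Longrightarrow> snd z \<in> S"
  shows "(\<Sum>b\<in>S. number Q zs b) = length (filter (\<lambda>z. Q (fst z)) zs)"
  using assms(2)
proof (induction zs)
  case Nil
  then show ?case by (simp add: number_def)
next
  case (Cons z zs)
  have n: "number Q (z # zs) b = (if snd z = b then (if Q (fst z) then 1 else 0) else 0) + number Q zs b" for b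
    by (simp add: number_def)
  have "(\<Sum>b\<in>S. number Q (z # zs) b) = (if snd z \<in> S then (if Q (fst z) then 1 else 0) else 0) + (\<Sum>b\<in>S. number Q zs b)"
    unfolding n sum.distrib using assms(1) by (simp add: sum.delta')
  then show ?case using Cons by auto
qed

text \<open>The weighting behind the bound on \<open>excess\<close> in \<open>endgame_state\<close>.
  In units of 1/42, the sizes 1/7 and 1/3 are 6 and 14; an item of size about 1/3 weighs 2, and one
  of size about 1/7 weighs 1 from the third in its bin on.\<close>

lemma weight_le:
  fixes a c :: nat
  assumes "6 * a + 14 * c \<le> 41" "0 < c"
  shows "2 * c + (a - 2) \<le> 4"
proof (cases "c = 1")
  case True
  then show ?thesis using assms by simp
next
  case False
  then have "c = 2" using assms by linarith
  then show ?thesis using assms by simp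
qed

lemma number_pos: "0 < number Q zs b \<longleftrightarrow> (\<exists>x. Q x \<and> (x, b) \<in> set zs)"
  by (force simp: number_def filter_empty_conv)

lemma sum_monus:
  fixes f :: "'b \<Rightarrow> nat"
  assumes "finite S"
  shows "sum f S \<le> (\<Sum>b\<in>S. f b - 2) + 2 * card S"
proof -
  have "sum f S \<le> (\<Sum>b\<in>S. (f b - 2) + 2)" by (rule sum_mono) simp
  also have "\<dots> = (\<Sum>b\<in>S. f b - 2) + (\<Sum>b\<in>S. 2)" by (rule sum.distrib)
  finally show ?thesis by simp
qed

lemma sum_number_all:
  assumes "bins ws \<subseteq> S" "finite S" "map fst ws = J" "\<And>x. x \<in> set J \<Longrightarrow> Q x"
  shows "(\<Sum>b\<in>S. number Q ws b) = length J"
proof -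
  have "(\<Sum>b\<in>S. number Q ws b) = length (filter (\<lambda>z. Q (fst z)) ws)"
    by (rule sum_number) (use assms(1,2) in \<open>auto simp: bins_def\<close>)
  also have "filter (\<lambda>z. Q (fst z)) ws = ws"
    by (rule filter_True) (use assms(3,4) in force)
  finally show ?thesis using arg_cong[OF assms(3), of length] by simp
qed

section \<open>The game after the tiny items\<close>

text \<open>
  The tiny items \<open>T\<close> consist of the items \<open>Ls\<close> that are first in their bins and of the others, \<open>Ss\<close>.
  A bin with one of the former cannot take an item of size \<open>1 - \<theta>\<close>, which fits with \<open>t\<close> of the latter.
\<close>

locale tiny_game =
  fixes A :: algorithm and t :: nat and R :: real and \<eta> \<theta> :: rat and T Ls Ss :: "item list"
  assumes alg: "online_algorithm t A" and t: "t = 2 \<or> t = 3" and R: "0 \<le> R"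
    and \<theta>: "0 < \<theta>" "\<theta> \<le> \<eta>" and \<eta>: "\<eta> \<le> 1 / 8000"
    and T_size: "\<And>x. x \<in> set T \<Longrightarrow> 0 < item_size x" "\<And>x. x \<in> set T \<Longrightarrow> item_size x \<le> \<eta>"
    and T_color: "map item_color T = [0..<length T]"
    and T_split: "mset T = mset Ls + mset Ss" "length Ls = card (bins (run A T))"
    and lead: "\<And>b. b \<in> bins (run A T) \<Longrightarrow> \<exists>x \<in> set Ls. (x, b) \<in> set (run A T)"
    and Ls: "\<And>x. x \<in> set Ls \<Longrightarrow> \<theta> < item_size x"
    and Ss: "\<And>x. x \<in> set Ss \<Longrightarrow> of_nat t * item_size x \<le> \<theta>"
    and comp: "\<And>J. valid_input J \<Longrightarrow> real (cost A (T @ J)) \<le> R * real (OPT t (T @ J))"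
begin

lemma valid_T: "valid_input T"
  unfolding valid_input_def
proof (intro ballI conjI)
  fix x assume "x \<in> set T"
  then show "0 < item_size x" "item_size x \<le> 1" using T_size[of x] \<eta> by linarith+
qed

lemma cost_le:
  assumes "valid_input J" "packs t k (mset (T @ J))"
  shows "real (cost A (T @ J)) \<le> R * real k"
proof -
  have "real (cost A (T @ J)) \<le> R * real (OPT t (T @ J))" by (rule comp) fact
  also have "\<dots> \<le> R * real k"
    by (intro mult_left_mono R of_nat_mono OPT_le assms)
  finally show ?thesis .
qed

lemma t\<eta>: "of_nat t * \<eta> \<le> 3 / 8000" "0 \<le> \<eta>" "1 \<le> t" "of_nat (t - 1) * \<eta> \<le> 2 / 8000"
  using t \<eta> \<theta> by auto

text \<open>The ending with huge items that fit with any \<open>t\<close> tiny items including one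
  of their color. Offline, the \<open>q\<close> bins for left-over tiny items absorb them; online,
  each needs a bin outside \<open>Z\<close> of its own.\<close>

lemma game_open:
  assumes J: "valid_input J" and base: "base_packs (of_nat (t - 1) * \<eta>) b (mset J)"
    and os: "mset os \<subseteq># mset T" "length os \<le> q" and cap: "length T \<le> (t - 1) * b + t * q"
    and Z: "Z \<subseteq> bins (run A (T @ J))"
    and bl: "\<And>x z. x \<in> set os \<Longrightarrow> z \<in> Z \<Longrightarrow>
      blocked t (run A (T @ J)) z (1 - of_nat t * \<eta>, item_color x)"
  shows "real (card Z + length os) \<le> R * real (b + q)"
proof -
  define H where "H = map (\<lambda>x. (1 - of_nat t * \<eta>, item_color x)) os"
  have H: "item_size x = 1 - of_nat t * \<eta>" if "x \<in> set H" for x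
    using that by (auto simp: H_def)
  have vH: "valid_input H" unfolding valid_input_def
  proof (intro ballI conjI)
    fix x assume "x \<in> set H"
    then show "0 < item_size x" "item_size x \<le> 1" using H[of x] t\<eta>(1,2) by simp_all
  qed
  obtain k where k: "k \<le> b + q" "packs t k (mset T + mset J + mset H)"
    using packs_huge[OF base t\<eta>(3,2) _ _ os(1,2)] t\<eta>(1) T_size(2) cap
    unfolding H_def by auto
  have "card Z + length H \<le> cost A ((T @ J) @ H) + card ({} :: nat set)"
  proof (rule cost_big_items[OF alg])
    show "valid_input ((T @ J) @ H)" using valid_T J vH by (simp add: valid_input_append)
    show "1 / 2 < item_size x" if "x \<in> set H" for x using H[OF that] t\<eta>(1) by simp
    show "blocked t (run A (T @ J)) z x" if "x \<in> set H" "z \<in> Z - {}" for x z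
      using that bl by (auto simp: H_def)
  qed (use Z in auto)
  then have "real (card Z + length os) \<le> real (cost A (T @ (J @ H)))"
    by (simp add: H_def)
  also have "\<dots> \<le> R * real k"
    by (rule cost_le) (use k J vH in \<open>auto simp: valid_input_append add.assoc\<close>)
  also have "\<dots> \<le> R * real (b + q)" by (intro mult_left_mono R) (use k in simp)
  finally show ?thesis .
qed

text \<open>A bin opened by tiny items contains one of \<open>Ls\<close>, and any other bin an item
  of \<open>J\<close>. Hence none of them has room for an item of size
  \<open>1 - \<theta>\<close>.\<close>

lemma load_gt:
  assumes "\<And>x. x \<in> set J \<Longrightarrow> \<theta> < item_size x" "b \<in> bins (run A (T @ J))"
  shows "\<theta> < load (run A (T @ J)) b"
proof -
  obtain ws where ws: "run A (T @ J) = run A T @ ws" "map fst ws = J" by (rule run_appendE)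
  have "fst z \<in> set (T @ J)" if "z \<in> set (run A (T @ J))" for z
    using that by (metis imageI list.set_map map_fst_run)
  moreover have pos: "0 \<le> item_size (fst z)" if "z \<in> set (run A (T @ J))" for z
  proof -
    have "fst z \<in> set T \<or> fst z \<in> set J" using that calculation by auto
    then show ?thesis using T_size(1)[of "fst z"] assms(1)[of "fst z"] \<theta>(1) by linarith
  qed
  have "\<exists>x. \<theta> < item_size x \<and> (x, b) \<in> set (run A (T @ J))"
  proof (cases "b \<in> bins (run A T)")
    case True
    then show ?thesis using lead Ls ws by force
  next
    case False
    then obtain x where "(x, b) \<in> set ws" using assms(2) by (auto simp: ws bins_append bins_def)
    moreover from this have "x \<in> set J" using ws(2) by force
    ultimately show ?thesis using assms(1) ws by (intro exI[of _ x]) auto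
  qed
  then show ?thesis using load_ge_member[OF pos] by (meson less_le_trans)
qed

text \<open>The ending with \<open>W\<close> and then \<open>h\<close> huge items of size
  \<open>1 - \<theta>\<close>. By \<open>load_gt\<close> the latter fit into no bin opened before
  \<open>W\<close>, while offline each shares a bin with \<open>t\<close> items of
  \<open>Ss\<close>. Among the bins in \<open>Z\<close>, only those in \<open>Y\<close> may take an
  item of \<open>W\<close>.\<close>

lemma game_small:
  assumes JW: "valid_input (J @ W)" and big: "\<And>x. x \<in> set W \<Longrightarrow> 1 / 2 < item_size x"
    and base: "base_packs (of_nat (t - 1) * \<eta>) b (mset (J @ W))"
    and h: "h * t \<le> length Ss" "h \<le> q" and cap: "length T \<le> (t - 1) * b + t * q"
    and J: "\<And>x. x \<in> set J \<Longrightarrow> \<theta> < item_size x"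
    and Z: "Z \<subseteq> bins (run A (T @ J))" and Y: "finite Y"
    and bl: "\<And>x z. x \<in> set W \<Longrightarrow> z \<in> Z - Y \<Longrightarrow> blocked t (run A (T @ J)) z x"
  shows "real (card Z + length W + h) \<le> R * real (b + q) + real (card Y)"
proof -
  \<comment> \<open>The items \<open>os\<close> lend their colors to the huge items,
    \<open>rs\<close> fill up the same bins, and \<open>us\<close> are packed together with
    \<open>Ls\<close>.\<close>
  define os rs us where "os = take h Ss" and "rs = take (h * (t - 1)) (drop h Ss)"
    and "us = drop (h * (t - 1)) (drop h Ss)"
  have ht: "h * t = h + h * (t - 1)" using t by auto
  have len: "length os = h" "length rs = h * (t - 1)" "length us = length Ss - h * t"
    using h ht by (auto simp: os_def rs_def us_def)
  have Seq: "Ss = os @ rs @ us" by (simp only: os_def rs_def us_def append_take_drop_id)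
  \<comment> \<open>With this bound on the sizes in \<open>Ss\<close>, \<open>packs_huge\<close>
    yields huge items of size exactly \<open>1 - \<theta>\<close>.\<close>
  define \<theta>' where "\<theta>' = \<theta> / of_nat t"
  have \<theta>': "of_nat t * \<theta>' = \<theta>" "0 \<le> \<theta>'" using t \<theta> by (auto simp: \<theta>'_def)
  have sm: "item_size x \<le> \<theta>'" if "x \<in> set Ss" for x
    using Ss[OF that] t by (auto simp: \<theta>'_def field_simps)
  define H where "H = map (\<lambda>x. (1 - of_nat t * \<theta>', item_color x)) os"
  have H: "item_size x = 1 - \<theta>" if "x \<in> set H" for x
    using that \<theta>' by (auto simp: H_def)
  have vH: "valid_input H" unfolding valid_input_def
  proof (intro ballI conjI)
    fix x assume "x \<in> set H"
    then show "0 < item_size x" "item_size x \<le> 1" using H[of x] \<theta> \<eta> by linarith+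
  qed
  have "\<exists>k \<le> 0 + h. packs t k (mset (os @ rs) + {#} + mset H)"
    unfolding H_def
  proof (rule packs_huge[OF base_packs_0 t\<eta>(3) \<theta>'(2)])
    show "of_nat t * \<theta>' \<le> 1" using \<theta>' \<theta> \<eta> by simp
    show "item_size x \<le> \<theta>'" if "x \<in># mset (os @ rs)" for x
      by (rule sm) (use that in \<open>auto simp: Seq\<close>)
    show "size (mset (os @ rs)) \<le> (t - 1) * 0 + t * h" using len ht by (simp add: mult.commute)
  qed (use len in auto)
  then obtain k1 where k1: "k1 \<le> h" "packs t k1 (mset (os @ rs) + mset H)" by auto
  have "mset T = mset (os @ rs) + (mset Ls + mset us)" using T_split(1) by (simp add: Seq ac_simps)
  moreover from this have "size (mset Ls + mset us) + h * t = length T"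
    using len ht by (metis add.commute length_append size_mset size_union)
  moreover have "item_size x \<le> \<eta>" if "x \<in># mset Ls + mset us" for x
  proof -
    have "x \<in># mset T" using that calculation(1) by simp
    then show ?thesis using T_size(2) by simp
  qed
  moreover have "t * q = t * (q - h) + h * t" using h(2) by (simp add: algebra_simps flip: diff_mult_distrib2)
  ultimately obtain k2 where k2: "k2 \<le> b + (q - h)" "packs t k2 (mset Ls + mset us + mset (J @ W))"
    using packs_huge[OF base t\<eta>(3,2), of "mset Ls + mset us" "[]" "q - h"] t\<eta>(1) cap by auto
  have k: "packs t (k1 + k2) (mset (T @ (J @ (W @ H))))" "k1 + k2 \<le> b + q"
    using packs_add[OF k1(2) k2(2)] k1(1) k2(1) h(2)
    by (auto simp: \<open>mset T = _\<close> ac_simps)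
  have "card Z + length (W @ H) \<le> cost A ((T @ J) @ (W @ H)) + card Y"
  proof (rule cost_big_items[OF alg _ _ Z Y])
    show "valid_input ((T @ J) @ W @ H)" using valid_T JW vH by (simp add: valid_input_append)
    show "1 / 2 < item_size x" if "x \<in> set (W @ H)" for x
    proof (cases "x \<in> set W")
      case False
      then have "item_size x = 1 - \<theta>" using that H by auto
      then show ?thesis using \<theta> \<eta> by linarith
    qed (rule big)
    show "blocked t (run A (T @ J)) z x" if "x \<in> set (W @ H)" "z \<in> Z - Y" for x z
    proof (cases "x \<in> set W")
      case False
      then have "item_size x = 1 - \<theta>" using that H by auto
      moreover have "\<theta> < load (run A (T @ J)) z" by (rule load_gt) (use that Z J in auto)
      ultimately show ?thesis by (simp add: blocked_def)
    qed (use that bl in auto)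
  qed
  then have "real (card Z + length W + h) \<le> real (cost A (T @ (J @ (W @ H)))) + real (card Y)"
    using len by (simp add: H_def)
  also have "real (cost A (T @ (J @ (W @ H)))) \<le> R * real (k1 + k2)"
    by (rule cost_le[OF _ k(1)]) (use JW vH in \<open>auto simp: valid_input_append\<close>)
  also have "\<dots> \<le> R * real (b + q)" by (intro mult_left_mono R of_nat_mono k(2))
  finally show ?thesis by simp
qed


text \<open>The items of size about 1/7 that are at least third of their size in a bin outside
  \<open>dead\<close>. The number carries their distribution over the bins into the weight bound of
  the endgame.\<close>

definition excess :: "item list \<Rightarrow> nat set \<Rightarrow> nat" where
  "excess J dead = (\<Sum>b\<in>{b \<in> bins (run A (T @ J)) - dead. 1 \<le> number isA (run A (T @ J)) b}.
    number isA (run A (T @ J)) b - 2)"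

text \<open>
  The game with \<open>n\<close> items of each size and one color. The bins in \<open>dead\<close> cannot take that color,
  \<open>k\<close> other bins contain items of size about \<open>1/7\<close> or \<open>1/3\<close>, and \<open>yC\<close> and \<open>yD\<close> of them can take items of
  size about \<open>1/2\<close> and \<open>2/3\<close>, respectively; \<open>P\<close> items of size about \<open>1/3\<close> are not first in their bin.
  An optimal packing needs \<open>l\<close> bins for the earlier items of other colors.
  The inequalities stem from ending with items of size about \<open>1/2\<close>, with \<open>P\<close> items of size about
  \<open>2/3\<close> and \<open>h\<close> huge ones, and with huge items only (of either kind).
\<close>

definition endgame_state ::
  "item list \<Rightarrow> nat set \<Rightarrow> nat \<Rightarrow> nat \<Rightarrow> nat \<Rightarrow> nat \<Rightarrow> nat \<Rightarrow> nat \<Rightarrow> bool" where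
  "endgame_state J dead l n k yC yD P \<longleftrightarrow>
    2 * P \<le> n \<and> 2 * yC + 2 * yD + 2 * n + excess J dead \<le> 4 * k \<and> yD + n \<le> k + P \<and>
    real (card dead + k + n) \<le> R * real (l + n) + real yC \<and>
    (\<forall>h q. h * t \<le> length Ss \<longrightarrow> h \<le> q \<longrightarrow>
      length T \<le> (t - 1) * (l + P + (n - P + 1) div 2 + (P + 5) div 6) + t * q \<longrightarrow>
      real (card dead + k + P + h) \<le> R * real (l + P + (n - P + 1) div 2 + (P + 5) div 6 + q) + real yD) \<and>
    (\<forall>h q. h * t \<le> length Ss \<longrightarrow> h \<le> q \<longrightarrow> length T \<le> (t - 1) * (l + n div 2) + t * q \<longrightarrow>
      real (card dead + k + h) \<le> R * real (l + n div 2 + q)) \<and>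
    (\<forall>os q. mset os \<subseteq># mset T \<longrightarrow>
      (\<forall>x\<in>set os. \<forall>b\<in>dead. item_color x \<notin> colors (run A (T @ J)) b) \<longrightarrow>
      length os \<le> q \<longrightarrow> length T \<le> (t - 1) * (l + n div 2) + t * q \<longrightarrow>
      real (card dead + k + length os) \<le> R * real (l + n div 2 + q))"

text \<open>To the \<open>n\<close> items of size about 1/7 in color \<kappa>, the bisection adds
  \<open>n\<close> items of size about 1/3. The first three inequalities come from counting bin by
  bin, the other four from one ending each, with \<open>X\<close> packed separately into
  \<open>l\<close> bins.\<close>

lemma endgame:
  fixes n l :: nat and \<kappa> :: color
  defines "r \<equiv> \<lambda>J. run A (T @ J)"
  assumes J: "\<And>x. x \<in> set J \<Longrightarrow> item_size x = sizeA"
    and dead: "dead \<subseteq> bins (r J)" "\<And>b. b \<in> dead \<Longrightarrow> \<kappa> \<notin> colors (r J) b"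
      "\<And>b. b \<in> dead \<Longrightarrow> t \<le> card (colors (r J) b)"
    and base: "base_packs (of_nat (t - 1) * \<eta>) l X" "mset J = X + replicate_mset n (sizeA, \<kappa>)"
    and n: "even n" "8 * \<eta> * 4 ^ (2 ^ n) \<le> 1 / 1000" and cap: "length T \<le> (t - 1) * (l + n)"
  shows "\<exists>k yC yD P. endgame_state J dead l n k yC yD P"
proof -

  \<comment> \<open>The adaptive items of size about 1/3\<close>
  define sB :: "nat \<Rightarrow> rat" where "sB c = 1003 / 3000 + 1 / 1000 / 4 ^ c" for c
  obtain ws Bl Bs L where ad: "run A ((T @ J) @ map fst ws) = run A (T @ J) @ ws" "length ws = n"
    "\<forall>i<n. \<exists>c \<le> 2 ^ n. fst (ws ! i) = (sB c, \<kappa>)"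
    "mset (map fst ws) = mset Bl + mset Bs" "length Bl = card (bins ws)"
    "\<forall>b \<in> bins ws. \<exists>x \<in> set Bl. (x, b) \<in> set ws" "L + 2 ^ (n - n) \<le> (2 :: nat) ^ n"
    "\<forall>x \<in> set Bl. \<exists>i<n. \<exists>c \<le> L. x = (sB c, \<kappa>)"
    "\<forall>x \<in> set Bs. \<exists>i<n. \<exists>c \<le> 2 ^ n. L + 2 ^ (n - n) \<le> c \<and> x = (sB c, \<kappa>)"
    using adaptive_sizes[of n n A "T @ J" "\<lambda>i c. (sB c, \<kappa>)"] by (auto 0 0)
  define v where "v = sB L"
  define K where "K = map fst ws"
  define zs where "zs = r J @ ws"
  have zs: "r (J @ K) = zs" using ad(1) by (simp add: zs_def r_def K_def)
  have antimono: "sB d \<le> sB c" if "c \<le> d" for c d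
    unfolding sB_def using power_increasing[OF that, of "4 :: rat"] by (simp add: frac_le)
  have Bl: "v \<le> item_size x" if "x \<in> set Bl" for x
    using ad(8)[rule_format, OF that] antimono by (auto simp: v_def)
  \<comment> \<open>A code that is larger by one divides the surplus over 1003/3000 by 4. The choice
    of \<eta> makes the difference at least \<open>4 * \<eta>\<close>, for every code that
    occurs.\<close>
  have gap: "sB (Suc L) + 4 * \<eta> \<le> v"
  proof -
    have "L \<le> 2 ^ n" using ad(7) by simp
    then have "(4 :: rat) ^ L \<le> 4 ^ (2 ^ n)" by (intro power_increasing) auto
    then have "8 * \<eta> * 4 ^ L \<le> 8 * \<eta> * 4 ^ (2 ^ n)" using t\<eta>(2) by (intro mult_left_mono) auto
    then have "8 * \<eta> * 4 ^ L \<le> 1 / 1000" using n(2) by linarith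
    then have "8 * \<eta> \<le> 1 / 1000 * (1 / 4 ^ L)" by (simp add: field_simps)
    moreover have "sB (Suc L) = 1003 / 3000 + 1 / 4000 * (1 / 4 ^ L)" by (simp add: sB_def)
    moreover have "v = 1003 / 3000 + 1 / 1000 * (1 / 4 ^ L)" by (simp add: v_def sB_def)
    moreover have "(0 :: rat) \<le> 1 / 4 ^ L" by simp
    ultimately show ?thesis by linarith
  qed
  have Bs: "item_size x + 4 * \<eta> \<le> v" if "x \<in> set Bs" for x
  proof -
    obtain c where "Suc L \<le> c" "x = (sB c, \<kappa>)" using ad(9)[rule_format, OF \<open>x \<in> set Bs\<close>] by auto
    then have "item_size x \<le> sB (Suc L)" using antimono by simp
    then show ?thesis using gap by linarith
  qed
  have K: "1003 / 3000 \<le> item_size x" "item_size x \<le> 1006 / 3000" "item_color x = \<kappa>"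
    if "x \<in> set K" for x
  proof -
    obtain i where "i < n" "x = fst (ws ! i)" using \<open>x \<in> set K\<close> ad(2) by (auto simp: K_def in_set_conv_nth)
    then obtain c where "x = (sB c, \<kappa>)" using ad(3) by metis
    moreover have "sB c \<le> sB 0" by (rule antimono) simp
    moreover have "1003 / 3000 \<le> sB c" by (simp add: sB_def)
    ultimately show "1003 / 3000 \<le> item_size x" "item_size x \<le> 1006 / 3000" "item_color x = \<kappa>"
      by (simp_all add: sB_def)
  qed
  have setK: "set K = set Bl \<union> set Bs" using mset_eq_setD[OF ad(4)[unfolded mset_append[symmetric]]] by (simp add: K_def)
  have lenK: "length K = n" using ad(2) by (simp add: K_def)
  have lenBB: "length Bl + length Bs = n" using arg_cong[OF ad(4), of size] ad(2) by simp
  have vJ: "valid_input J" unfolding valid_input_def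
  proof (intro ballI conjI)
    fix x assume "x \<in> set J"
    then show "0 < item_size x" "item_size x \<le> 1" using J[of x] by linarith+
  qed
  have vK: "valid_input K" unfolding valid_input_def
  proof (intro ballI conjI)
    fix x assume "x \<in> set K"
    then show "0 < item_size x" "item_size x \<le> 1" using K(1,2)[of x] by linarith+
  qed
  have vTJK: "valid_input (T @ J @ K)" using valid_T vJ vK by (simp add: valid_input_append)
  have memzs: "fst z \<in> set T \<union> set J \<union> set K" if "z \<in> set zs" for z
  proof -
    have "fst z \<in> set (map fst (r (J @ K)))" using that zs by simp
    then show ?thesis by (simp add: r_def del: set_map)
  qed
  have pos: "0 \<le> item_size (fst z)" if "z \<in> set zs" for z
  proof -
    have "fst z \<in> set (T @ J @ K)" using memzs[OF that] by simp
    then show ?thesis using vTJK unfolding valid_input_def by (meson less_imp_le)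
  qed
  have feas: "load zs b \<le> 1" "card (colors zs b) \<le> t" for b
    using run_feasible[OF alg vTJK, of b] zs by (simp_all add: r_def)
  \<comment> \<open>In a dead bin, \<kappa> would be a color beyond the limit
    \<open>t\<close>.\<close>
  have dead_ws: "b \<notin> bins ws" if "b \<in> dead" for b
  proof
    assume "b \<in> bins ws"
    then obtain x where x: "(x, b) \<in> set ws" by (auto simp: bins_def)
    then have "x \<in> set K" by (force simp: K_def)
    moreover have "item_color x \<in> colors ws b" using x by (force simp: colors_def)
    ultimately have "insert \<kappa> (colors (r J) b) \<subseteq> colors zs b"
      using K(3)[of x] by (simp add: zs_def colors_append)
    then have "card (insert \<kappa> (colors (r J) b)) \<le> t"
      by (meson card_mono feas(2) finite_colors le_trans)
    then show False using dead(2,3)[OF that] by simp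
  qed
  have dead_col: "colors zs b = colors (r J) b" if "b \<in> dead" for b
    using dead_ws[OF that] by (force simp: zs_def colors_append colors_def bins_def)

  \<comment> \<open>Items of sizes about 1/7 and 1/3 in each bin\<close>
  define a \<beta> where "a = number isA zs" and "\<beta> = number isB zs"
  have isAK: "\<not> isA x" if "x \<in> set K" for x using K(1)[OF that] by (auto simp: isA_def)
  have isBTJ: "\<not> isB x" if "x \<in> set (T @ J)" for x
  proof -
    have "item_size x \<le> \<eta> \<or> item_size x = sizeA" using that T_size(2)[of x] J[of x] by auto
    then show ?thesis unfolding isB_def using \<eta> by linarith
  qed
  have aJ: "a b = number isA (r J) b" for b
  proof -
    have "number isA ws b = 0" unfolding number_def using isAK by (force simp: K_def filter_empty_conv)
    then show ?thesis by (simp add: a_def zs_def number_append)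
  qed
  have rTJ: "fst z \<in> set (T @ J)" if "z \<in> set (r J)" for z
  proof -
    have "fst z \<in> set (map fst (r J))" using that by simp
    then show ?thesis by (simp add: r_def del: set_map)
  qed
  have \<beta>ws: "\<beta> b = number (\<lambda>_. True) ws b" for b
  proof -
    have "number isB (r J) b = 0" unfolding number_def using isBTJ rTJ by (force simp: filter_empty_conv)
    moreover have "number isB ws b = number (\<lambda>_. True) ws b"
      unfolding number_def by (intro arg_cong[where f = length] filter_cong) (use K(1) in \<open>auto simp: isB_def K_def\<close>)
    ultimately show ?thesis by (simp add: \<beta>_def zs_def number_append)
  qed
  have \<beta>pos: "0 < \<beta> b \<longleftrightarrow> b \<in> bins ws" for b
    unfolding \<beta>ws number_pos by (force simp: bins_def)
  have load_ab: "sizeA * of_nat (a b) + (1003 / 3000) * of_nat (\<beta> b) \<le> load (r (J @ K)) b" for b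
    unfolding zs a_def \<beta>_def by (rule load_ge_numbers) (rule pos)
  have one_le: "(1 :: rat) \<le> of_nat (a b) + of_nat (\<beta> b)" if "0 < a b + \<beta> b" for b
  proof -
    have "(of_nat 1 :: rat) \<le> of_nat (a b + \<beta> b)" by (rule of_nat_mono) (use that in linarith)
    then show ?thesis by simp
  qed
  \<comment> \<open>All sizes are strictly above 1/7 and 1/3, so the count in units of 1/42 stays
    strictly below 42.\<close>
  have wt: "6 * a b + 14 * \<beta> b \<le> 41" if "0 < a b + \<beta> b" for b
  proof (rule ccontr)
    assume "\<not> 6 * a b + 14 * \<beta> b \<le> 41"
    then have "42 \<le> 6 * a b + 14 * \<beta> b" by simp
    then have "(of_nat 42 :: rat) \<le> of_nat (6 * a b + 14 * \<beta> b)" by (rule of_nat_mono)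
    then have "(42 :: rat) \<le> 6 * of_nat (a b) + 14 * of_nat (\<beta> b)" by simp
    moreover have "(1 :: rat) \<le> of_nat (a b) + of_nat (\<beta> b)" by (rule one_le) fact
    moreover have "sizeA * of_nat (a b) + (1003 / 3000) * of_nat (\<beta> b) \<le> 1"
      using load_ab[of b] feas(1)[of b] unfolding zs by (rule order.trans)
    ultimately show False by linarith
  qed
  \<comment> \<open>\<open>Kd\<close> are the live bins in use. Among them, only those in
    \<open>YC\<close> may have load below 1/2, and only those in \<open>YD\<close> may have room for
    an item of size about 2/3.\<close>
  define Kd where "Kd = {b \<in> bins zs - dead. 0 < a b + \<beta> b}"
  define YD where "YD = {b \<in> Kd. \<beta> b = 0 \<and> a b \<le> 2}"
  define YC where "YC = {b \<in> Kd. 6 * a b + 14 * \<beta> b \<le> 20}"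
  have fin: "finite Kd" "finite YD" "finite YC" by (simp_all add: Kd_def YD_def YC_def)
  have wsKd: "bins ws \<subseteq> Kd" using dead_ws \<beta>pos by (auto simp: Kd_def zs_def bins_append)
  have sum\<beta>: "(\<Sum>b\<in>Kd. \<beta> b) = n"
    unfolding \<beta>ws using sum_number[OF fin(1), of ws "\<lambda>_. True"] wsKd ad(2) by (auto simp: bins_def)
  have Z: "dead \<union> Kd \<subseteq> bins (r (J @ K))" using dead(1) by (auto simp: Kd_def zs zs_def bins_append)
  have cardZ: "card (dead \<union> Kd) = card dead + card Kd"
  proof (rule card_Un_disjoint)
    show "finite dead" by (rule finite_subset[OF dead(1) finite_bins])
  qed (use fin in \<open>auto simp: Kd_def\<close>)
  define k P where "k = card Kd" and "P = length Bs"
  have Pn: "P + card (bins ws) = n" using lenBB ad(5) by (simp add: P_def)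
  have bl_dead: "blocked t (r (J @ K)) b x" if "b \<in> dead" "item_color x \<notin> colors (r J) b" for b x
    using that dead(3) dead_col unfolding zs blocked_def by auto
  have base_small: "\<theta> < item_size x" if "x \<in> set (J @ K)" for x
  proof (cases "x \<in> set J")
    case True
    then show ?thesis using J[of x] \<theta> \<eta> by linarith
  next
    case False
    then have "x \<in> set K" using that by simp
    then show ?thesis using K(1)[of x] \<theta> \<eta> by linarith
  qed

  \<comment> \<open>Counting inequalities\<close>
  have P1: "2 * card YC + 2 * card YD + 2 * n + (\<Sum>b\<in>{b \<in> bins (r J) - dead. 1 \<le> number isA (r J) b}. number isA (r J) b - 2) \<le> 4 * k"
  proof -
    have "(\<Sum>b\<in>{b \<in> bins (r J) - dead. 1 \<le> number isA (r J) b}. number isA (r J) b - 2) \<le> (\<Sum>b\<in>Kd. a b - 2)"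
      unfolding aJ by (rule sum_mono2) (auto simp: fin Kd_def aJ zs_def bins_append)
    \<comment> \<open>Without items of size about 1/3, a bin with up to two items of size about 1/7
      is in both sets, with three in \<open>YC\<close> only, with more in neither. Otherwise
      \<open>YC\<close> demands a single item of size about 1/3 and at most one of size about
      1/7.\<close>
    moreover have "(\<Sum>b\<in>Kd. 2 * (if b \<in> YC then 1 else 0) + 2 * (if b \<in> YD then 1 else 0) + 2 * \<beta> b + (a b - 2)) \<le> (\<Sum>b\<in>Kd. 4)"
    proof (rule sum_mono)
      fix b assume "b \<in> Kd"
      then have "0 < a b + \<beta> b" by (simp add: Kd_def)
      moreover from this have "6 * a b + 14 * \<beta> b \<le> 41" by (rule wt)
      ultimately show "2 * (if b \<in> YC then 1 else 0) + 2 * (if b \<in> YD then 1 else 0) + 2 * \<beta> b + (a b - 2) \<le> 4"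
        using \<open>b \<in> Kd\<close> weight_le by (auto simp: YC_def YD_def)
    qed
    moreover have "(\<Sum>b\<in>Kd. if b \<in> YC then 1 else 0) = card YC" "(\<Sum>b\<in>Kd. if b \<in> YD then 1 else 0) = card YD"
      using fin by (simp_all add: sum.If_cases YC_def YD_def Int_def conj_commute)
    ultimately show ?thesis
      using sum\<beta> by (simp add: sum.distrib k_def flip: sum_distrib_left)
  qed
  \<comment> \<open>\<open>Bl\<close> has one item per bin that received items of size about 1/3, so
    there are \<open>n - P\<close> such bins, and none is in \<open>YD\<close>.\<close>
  have P2: "card YD + n \<le> k + P"
  proof -
    have "YD \<inter> bins ws = {}" by (auto simp: YD_def simp flip: \<beta>pos)
    then have "card YD + card (bins ws) = card (YD \<union> bins ws)"
      using fin by (simp add: card_Un_disjoint)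
    also have "\<dots> \<le> k" unfolding k_def
      by (rule card_mono) (use fin wsKd in \<open>auto simp: YD_def\<close>)
    finally show ?thesis using Pn by linarith
  qed
  \<comment> \<open>At most two items of size above 1/3 share a bin, so at least half of them are
    first in their bins.\<close>
  have P3: "2 * P \<le> n"
  proof -
    have "n = (\<Sum>b\<in>bins ws. \<beta> b)"
      unfolding \<beta>ws using sum_number[of "bins ws" ws "\<lambda>_. True"] ad(2) by (auto simp: bins_def)
    also have "\<dots> \<le> (\<Sum>b\<in>bins ws. 2)"
    proof (rule sum_mono)
      fix b assume "b \<in> bins ws"
      then have "6 * a b + 14 * \<beta> b \<le> 41" using wt \<beta>pos by simp
      then show "\<beta> b \<le> 2" by simp
    qed
    finally show ?thesis using Pn by simp
  qed

  \<comment> \<open>The four endings\<close>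
  have unitsum: "sum_list (map (\<lambda>x. F + {#x#}) xs) = repeat_mset (length xs) F + mset xs"
    for F :: "item multiset" and xs by (induction xs) auto
  have C: "real (card dead + k + n) \<le> R * real (l + n) + real (card YC)"
  proof -
    define W where "W = replicate n (sizeC, \<kappa>)"
    have "real (card (dead \<union> Kd) + length W + 0) \<le> R * real (l + n + 0) + real (card YC)"
    proof (rule game_small)
      show "valid_input ((J @ K) @ W)"
        using vJ vK by (simp add: valid_input_append W_def) (simp add: valid_input_def)
      show "1 / 2 < item_size x" if "x \<in> set W" for x using that by (simp add: W_def)
      \<comment> \<open>One item of each of the three sizes per bin: 41/42 plus surpluses of at most
        1/1000, 2/1000 and 1/1000.\<close>
      have "base_packs (of_nat (t - 1) * \<eta>) ((length (map (\<lambda>x. {#(sizeA, \<kappa>), (sizeC, \<kappa>)#} + {#x#}) K) + 1 - 1) div 1)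
          (sum_list (map (\<lambda>x. {#(sizeA, \<kappa>), (sizeC, \<kappa>)#} + {#x#}) K))"
      proof (rule base_packs_units[where s = "41 / 42 + 4 / 1000" and c = \<kappa>])
        fix U assume "U \<in> set (map (\<lambda>x. {#(sizeA, \<kappa>), (sizeC, \<kappa>)#} + {#x#}) K)"
        then obtain x where x: "x \<in> set K" "U = {#(sizeA, \<kappa>), (sizeC, \<kappa>)#} + {#x#}" by auto
        show "(\<Sum>x\<in>#U. item_size x) \<le> 41 / 42 + 4 / 1000" using x(2) K(2)[OF x(1)] by simp
        show "item_color y = \<kappa>" if "y \<in># U" for y using that x K(3)[of x] by auto
      qed (use t\<eta>(4) in auto)
      then have "base_packs (of_nat (t - 1) * \<eta>) n (repeat_mset n {#(sizeA, \<kappa>), (sizeC, \<kappa>)#} + mset K)"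
        unfolding unitsum using lenK by simp
      from base_packs_add[OF base(1) this]
      show "base_packs (of_nat (t - 1) * \<eta>) (l + n) (mset ((J @ K) @ W))"
        by (simp add: base(2) W_def ac_simps flip: mset_replicate)
      show "length T \<le> (t - 1) * (l + n) + t * 0" using cap by simp
      show "\<theta> < item_size x" if "x \<in> set (J @ K)" for x using that by (rule base_small)
      show "dead \<union> Kd \<subseteq> bins (run A (T @ J @ K))" using Z by (simp add: r_def)
      show "blocked t (run A (T @ J @ K)) z x" if "x \<in> set W" "z \<in> dead \<union> Kd - YC" for x z
      proof (cases "z \<in> dead")
        case True
        then show ?thesis using bl_dead[of z x] dead(2) that by (auto simp: W_def r_def)
      next
        case False
        then have "21 \<le> 6 * a z + 14 * \<beta> z" "0 < a z + \<beta> z" using that by (auto simp: YC_def Kd_def)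
        then have "(of_nat 21 :: rat) \<le> of_nat (6 * a z + 14 * \<beta> z)" by (intro of_nat_mono)
        then have "(21 :: rat) \<le> 6 * of_nat (a z) + 14 * of_nat (\<beta> z)" by simp
        moreover have "(0 :: rat) \<le> of_nat (\<beta> z)" "(0 :: rat) \<le> of_nat (a z)" by simp_all
        ultimately have "1 / 2 \<le> load (r (J @ K)) z" using load_ab[of z] by linarith
        then show ?thesis using that by (auto simp: blocked_def r_def W_def)
      qed
    qed (use fin in auto)
    then show ?thesis by (simp add: cardZ k_def W_def)
  qed
  have D: "real (card dead + k + P + h) \<le> R * real (l + P + (n - P + 1) div 2 + (P + 5) div 6 + q) + real (card YD)"
    if h: "h * t \<le> length Ss" "h \<le> q"
      and cap: "length T \<le> (t - 1) * (l + P + (n - P + 1) div 2 + (P + 5) div 6) + t * q" for h q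
  proof -
    \<comment> \<open>Too large for a bin with an item of \<open>Bl\<close>, whose size is at least
      \<open>v\<close>, but by \<open>gap\<close> it fits with an item of \<open>Bs\<close> and two
      tiny items.\<close>
    define sD where "sD = 1 - v + \<eta>"
    have v: "1003 / 3000 \<le> v" "v \<le> 1006 / 3000"
      using antimono[of 0 L] by (auto simp: v_def sB_def)
    define W where "W = replicate P (sD, \<kappa>)"
    have "real (card (dead \<union> Kd) + length W + h)
        \<le> R * real (l + P + (n - P + 1) div 2 + (P + 5) div 6 + q) + real (card YD)"
    proof (rule game_small[OF _ _ _ h cap])
      show "valid_input ((J @ K) @ W)"
        using vJ vK v \<eta> t\<eta>(2) by (simp add: valid_input_append W_def) (simp add: valid_input_def sD_def)
      show "1 / 2 < item_size x" if "x \<in> set W" for x using that v t\<eta>(2) by (simp add: W_def sD_def)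
      have t\<eta>': "of_nat (t - 1) * \<eta> \<le> 2 * \<eta>" using t t\<eta>(2) by auto
      \<comment> \<open>Offline, \<open>W\<close> is matched with \<open>Bs\<close>. The items of
        \<open>Bl\<close> are paired with items of size about 1/7, two pairs per bin, and the other
        \<open>P\<close> items of size about 1/7 go six to a bin.\<close>
      have "base_packs (of_nat (t - 1) * \<eta>) ((length (map (\<lambda>x. {#(sD, \<kappa>)#} + {#x#}) Bs) + 1 - 1) div 1)
          (sum_list (map (\<lambda>x. {#(sD, \<kappa>)#} + {#x#}) Bs))"
      proof (rule base_packs_units[where s = "1 - 2 * \<eta>" and c = \<kappa>])
        fix U assume "U \<in> set (map (\<lambda>x. {#(sD, \<kappa>)#} + {#x#}) Bs)"
        then obtain x where x: "x \<in> set Bs" "U = {#(sD, \<kappa>)#} + {#x#}" by auto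
        then show "(\<Sum>x\<in>#U. item_size x) \<le> 1 - 2 * \<eta>" using Bs[OF x(1)] t\<eta>(2) by (simp add: sD_def)
        show "item_color y = \<kappa>" if "y \<in># U" for y using that x K(3)[of x] setK by auto
      qed (use t\<eta>' \<eta> in auto)
      then have b1: "base_packs (of_nat (t - 1) * \<eta>) P (repeat_mset P {#(sD, \<kappa>)#} + mset Bs)"
        unfolding unitsum by (simp add: P_def)
      have "base_packs (of_nat (t - 1) * \<eta>) ((length (map (\<lambda>x. {#(sizeA, \<kappa>)#} + {#x#}) Bl) + 2 - 1) div 2)
          (sum_list (map (\<lambda>x. {#(sizeA, \<kappa>)#} + {#x#}) Bl))"
      proof (rule base_packs_units[where s = "10 / 21 + 3 / 1000" and c = \<kappa>])
        fix U assume "U \<in> set (map (\<lambda>x. {#(sizeA, \<kappa>)#} + {#x#}) Bl)"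
        then obtain x where "x \<in> set Bl" and x: "U = {#(sizeA, \<kappa>)#} + {#x#}" by auto
        then have xK: "x \<in> set K" using setK by simp
        show "(\<Sum>x\<in>#U. item_size x) \<le> 10 / 21 + 3 / 1000" using x K(2)[OF xK] by simp
        show "item_color y = \<kappa>" if "y \<in># U" for y using that x K(3)[OF xK] by auto
      qed (use t\<eta>(4) in auto)
      then have b2: "base_packs (of_nat (t - 1) * \<eta>) ((n - P + 1) div 2) (repeat_mset (n - P) {#(sizeA, \<kappa>)#} + mset Bl)"
        unfolding unitsum using lenBB by (simp add: P_def flip: lenBB)
      have "base_packs (of_nat (t - 1) * \<eta>) ((length (replicate P {#(sizeA, \<kappa>)#}) + 6 - 1) div 6)
          (sum_list (replicate P {#(sizeA, \<kappa>)#}))"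
        by (rule base_packs_units[where s = sizeA and c = \<kappa>]) (use t\<eta>(4) in \<open>auto simp: algebra_simps\<close>)
      moreover have "sum_list (replicate P {#(sizeA, \<kappa>)#}) = replicate_mset P (sizeA, \<kappa>)"
        by (induction P) auto
      ultimately have b3: "base_packs (of_nat (t - 1) * \<eta>) ((P + 5) div 6) (replicate_mset P (sizeA, \<kappa>))"
        by (simp add: add.commute)
      have rep: "replicate_mset n (sizeA, \<kappa>) = replicate_mset (n - P) (sizeA, \<kappa>) + replicate_mset P (sizeA, \<kappa>)"
        using P3 by (intro multiset_eqI) simp
      show "base_packs (of_nat (t - 1) * \<eta>) (l + P + (n - P + 1) div 2 + (P + 5) div 6) (mset ((J @ K) @ W))"
        using base_packs_add[OF base_packs_add[OF base_packs_add[OF base(1) b1] b2] b3] ad(4)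
        by (simp add: base(2) W_def rep ac_simps K_def)
      show "\<theta> < item_size x" if "x \<in> set (J @ K)" for x using that by (rule base_small)
      show "dead \<union> Kd \<subseteq> bins (run A (T @ J @ K))" using Z by (simp add: r_def)
      show "blocked t (run A (T @ J @ K)) z x" if xz: "x \<in> set W" "z \<in> dead \<union> Kd - YD" for x z
      proof -
        have x: "x = (sD, \<kappa>)" using xz(1) by (simp add: W_def)
        consider "z \<in> dead" | "z \<in> bins ws" | "3 \<le> a z" "\<beta> z = 0"
          using xz(2) \<beta>pos[of z] by (fastforce simp: YD_def)
        then show ?thesis
        proof cases
          case 1
          then show ?thesis using bl_dead[of z x] dead(2) x by (auto simp: r_def)
        next
          case 2
          then obtain y where y: "y \<in> set Bl" "(y, z) \<in> set ws" using ad(6) by auto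
          then have "item_size y \<le> load zs z" by (intro load_ge_member pos) (auto simp: zs_def)
          then have "1 < load (r (J @ K)) z + sD"
            using Bl[OF y(1)] \<theta> by (simp add: zs sD_def)
          then show ?thesis by (simp add: blocked_def x r_def)
        next
          case 3
          then have "(of_nat 3 :: rat) \<le> of_nat (a z)" by (intro of_nat_mono)
          then have "3 / 7 \<le> load (r (J @ K)) z" using load_ab[of z] 3 by simp
          then have "1 < load (r (J @ K)) z + sD" using v t\<eta>(2) by (simp add: sD_def)
          then show ?thesis by (simp add: blocked_def x r_def)
        qed
      qed
    qed (use fin in auto)
    then show ?thesis by (simp add: cardZ k_def W_def)
  qed
  \<comment> \<open>For the endings with huge items only: two pairs of sizes about 1/7 and 1/3 in a
    bin, about 20/21 in total.\<close>
  have baseS: "base_packs (of_nat (t - 1) * \<eta>) (l + n div 2) (mset (J @ K))"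
  proof -
    have "base_packs (of_nat (t - 1) * \<eta>) ((length (map (\<lambda>x. {#(sizeA, \<kappa>)#} + {#x#}) K) + 2 - 1) div 2)
        (sum_list (map (\<lambda>x. {#(sizeA, \<kappa>)#} + {#x#}) K))"
    proof (rule base_packs_units[where s = "10 / 21 + 3 / 1000" and c = \<kappa>])
      fix U assume "U \<in> set (map (\<lambda>x. {#(sizeA, \<kappa>)#} + {#x#}) K)"
      then obtain x where "x \<in> set K" and x: "U = {#(sizeA, \<kappa>)#} + {#x#}" by auto
      then have xK: "x \<in> set K" using setK by simp
      show "(\<Sum>x\<in>#U. item_size x) \<le> 10 / 21 + 3 / 1000" using x K(2)[OF xK] by simp
      show "item_color y = \<kappa>" if "y \<in># U" for y using that x K(3)[OF xK] by auto
    qed (use t\<eta>(4) in auto)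
    then have "base_packs (of_nat (t - 1) * \<eta>) (n div 2) (repeat_mset n {#(sizeA, \<kappa>)#} + mset K)"
      unfolding unitsum using lenK n(1) by simp
    from base_packs_add[OF base(1) this] show ?thesis
      by (simp add: base(2) ac_simps)
  qed
  have S3: "real (card dead + k + h) \<le> R * real (l + n div 2 + q)"
    if h: "h * t \<le> length Ss" "h \<le> q" and cap: "length T \<le> (t - 1) * (l + n div 2) + t * q" for h q
  proof -
    have "real (card (dead \<union> Kd) + length ([] :: item list) + h) \<le> R * real (l + n div 2 + q) + real (card ({} :: nat set))"
    proof (rule game_small[OF _ _ _ h cap])
      show "valid_input ((J @ K) @ [])" using vJ vK by (simp add: valid_input_append)
      show "base_packs (of_nat (t - 1) * \<eta>) (l + n div 2) (mset ((J @ K) @ []))" using baseS by simp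
      show "\<theta> < item_size x" if "x \<in> set (J @ K)" for x using that by (rule base_small)
      show "dead \<union> Kd \<subseteq> bins (run A (T @ J @ K))" using Z by (simp add: r_def)
    qed auto
    then show ?thesis by (simp add: cardZ k_def)
  qed
  have S3': "real (card dead + k + length os) \<le> R * real (l + n div 2 + q)"
    if os: "mset os \<subseteq># mset T" "\<forall>x\<in>set os. \<forall>b\<in>dead. item_color x \<notin> colors (r J) b" "length os \<le> q"
      and cap: "length T \<le> (t - 1) * (l + n div 2) + t * q" for os q
  proof -
    have "real (card (dead \<union> Kd) + length os) \<le> R * real (l + n div 2 + q)"
    proof (rule game_open[OF _ baseS os(1,3) cap])
      show "valid_input (J @ K)" using vJ vK by (simp add: valid_input_append)
      show "dead \<union> Kd \<subseteq> bins (run A (T @ J @ K))" using Z by (simp add: r_def)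
      show "blocked t (run A (T @ J @ K)) z (1 - of_nat t * \<eta>, item_color x)"
        if "x \<in> set os" "z \<in> dead \<union> Kd" for x z
      proof (cases "z \<in> dead")
        case True
        then show ?thesis using bl_dead[of z "(1 - of_nat t * \<eta>, item_color x)"] os(2) that by (auto simp: r_def)
      next
        case False
        then have "0 < a z + \<beta> z" using that by (auto simp: Kd_def)
        then have "(1 :: rat) \<le> of_nat (a z) + of_nat (\<beta> z)" by (rule one_le)
        moreover have "(0 :: rat) \<le> of_nat (\<beta> z)" "(0 :: rat) \<le> of_nat (a z)" by simp_all
        ultimately have "1 / 7 \<le> load (r (J @ K)) z" using load_ab[of z] by linarith
        then show ?thesis using t\<eta>(1) by (simp add: blocked_def r_def)
      qed
    qed
    then show ?thesis by (simp add: cardZ k_def)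
  qed
  have "endgame_state J dead l n k (card YC) (card YD) P"
    unfolding endgame_state_def excess_def using P1 P2 P3 C D S3 S3' by (simp add: r_def)
  then show ?thesis by blast
qed


section \<open>Colors of the bins after the tiny items\<close>

abbreviation "N \<equiv> length T"

lemma distinct_colors: "distinct (map (\<lambda>z. item_color (fst z)) (run A T))"
proof -
  have "map (\<lambda>z. item_color (fst z)) (run A T) = map item_color (map fst (run A T))"
    by (simp only: map_map o_def)
  also have "\<dots> = [0..<N]" by (simp only: map_fst_run T_color)
  finally show ?thesis by simp
qed

lemma number_T: "number (\<lambda>_. True) (run A T) b = card (colors (run A T) b)"
proof -
  have "distinct (map (\<lambda>z. item_color (fst z)) (run A T))" by (rule distinct_colors)
  then have "distinct (map (\<lambda>z. item_color (fst z)) (filter (\<lambda>z. snd z = b) (run A T)))"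
    by (rule distinct_map_filter)
  then have "card (set (map (\<lambda>z. item_color (fst z)) (filter (\<lambda>z. snd z = b) (run A T))))
      = length (map (\<lambda>z. item_color (fst z)) (filter (\<lambda>z. snd z = b) (run A T)))"
    by (rule distinct_card)
  moreover have "set (map (\<lambda>z. item_color (fst z)) (filter (\<lambda>z. snd z = b) (run A T))) = colors (run A T) b"
    by (simp add: colors_def)
  ultimately show ?thesis by (simp add: number_def)
qed

lemma sum_colors_T: "(\<Sum>b\<in>bins (run A T). card (colors (run A T) b)) = N"
  unfolding number_T[symmetric]
  using sum_number[of "bins (run A T)" "run A T" "\<lambda>_. True"] by (auto simp: bins_def)

lemma color_less: "x \<in> set T \<Longrightarrow> item_color x < N"
  using T_color by (metis atLeastLessThan_iff image_eqI list.set_map set_upt)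

lemma mem_run: "z \<in> set (run A I) \<Longrightarrow> fst z \<in> set I"
  by (metis imageI list.set_map map_fst_run)

lemma colors_T_less: "c \<in> colors (run A T) b \<Longrightarrow> c < N"
  unfolding colors_def using color_less[OF mem_run] by auto

lemma colors_T_card:
  assumes "b \<in> bins (run A T)"
  shows "1 \<le> card (colors (run A T) b)" "card (colors (run A T) b) \<le> t"
proof -
  have "colors (run A T) b \<noteq> {}" using assms unfolding bins_def colors_def by blast
  then show "1 \<le> card (colors (run A T) b)" by (simp add: Suc_le_eq card_gt_0_iff)
  show "card (colors (run A T) b) \<le> t" by (rule run_feasible[OF alg valid_T])
qed

text \<open>The colors of a bin only accumulate, and a further one would exceed
  \<open>t\<close>.\<close>

lemma full_bin:
  assumes "valid_input (I @ J)" "t \<le> card (colors (run A I) b)"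
  shows "colors (run A (I @ J)) b = colors (run A I) b"
proof -
  obtain ws where ws: "run A (I @ J) = run A I @ ws" by (rule run_appendE)
  then have "colors (run A I) b \<subseteq> colors (run A (I @ J)) b" by (simp add: colors_append)
  moreover have "card (colors (run A (I @ J)) b) \<le> card (colors (run A I) b)"
    using run_feasible(2)[OF alg assms(1), of b] assms(2) by linarith
  ultimately show ?thesis using card_seteq[of "colors (run A (I @ J)) b" "colors (run A I) b"] by simp
qed

definition full :: "nat set" where
  "full = {b \<in> bins (run A T). card (colors (run A T) b) = t}"

text \<open>The tiny items whose colors are absent from all full bins. A huge item of such a color
  is kept out of the full bins by the color limit.\<close>

definition Os :: "item list" where
  "Os = map fst (filter (\<lambda>z. snd z \<notin> full) (run A T))"

lemma Os_sub: "mset (take h Os) \<subseteq># mset T"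
proof -
  have "mset (take h Os) \<subseteq># mset Os"
    by (metis append_take_drop_id mset_append mset_subset_eq_add_left)
  also have "mset Os \<subseteq># mset (map fst (run A T))"
    unfolding Os_def mset_map by (intro image_mset_subseteq_mono) (simp add: multiset_filter_subset)
  finally show ?thesis by simp
qed

lemma length_Os: "length Os + t * card full = N"
proof -
  have "t * card full = (\<Sum>b\<in>full. number (\<lambda>_. True) (run A T) b)"
    unfolding number_T by (simp add: full_def)
  also have "\<dots> = (\<Sum>b\<in>full. number (\<lambda>_. True) (filter (\<lambda>z. snd z \<in> full) (run A T)) b)"
    by (intro sum.cong refl) (simp add: number_def conj_commute cong: conj_cong filter_cong)
  also have "\<dots> = length (filter (\<lambda>z. snd z \<in> full) (run A T))"
    using sum_number[of full "filter (\<lambda>z. snd z \<in> full) (run A T)" "\<lambda>_. True"] by (simp add: full_def)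
  finally show ?thesis
    using sum_length_filter_compl[of "\<lambda>z. snd z \<in> full" "run A T"] by (simp add: Os_def)
qed

lemma Os_color:
  assumes "x \<in> set Os" "b \<in> full"
  shows "item_color x \<notin> colors (run A T) b"
proof
  assume "item_color x \<in> colors (run A T) b"
  then obtain z where z: "z \<in> set (run A T)" "snd z = b" "item_color (fst z) = item_color x"
    by (auto simp: colors_def)
  obtain y where y: "y \<in> set (run A T)" "snd y \<notin> full" "fst y = x"
    using assms(1) by (auto simp: Os_def)
  have "distinct (map (\<lambda>z. item_color (fst z)) (run A T))" by (rule distinct_colors)
  then have "inj_on (\<lambda>z. item_color (fst z)) (set (run A T))" by (simp add: distinct_map)
  then have "z = y" using z y by (auto dest: inj_onD)
  then show False using z y assms(2) by simp
qed

lemma length_Ss: "card (bins (run A T)) + length Ss = N"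
  using T_split(2) arg_cong[OF T_split(1), of size] by simp

text \<open>The ending right after the tiny items, with one huge item per group of \<open>t\<close>
  items of \<open>Ss\<close>. As \<open>Ss\<close> contains all tiny items but one per bin, this
  bounds the number of bins opened.\<close>

lemma stage0:
  assumes "t * q = N"
  shows "real (card (bins (run A T)) + length Ss div t) \<le> R * real q"
proof -
  have "real (card (bins (run A T)) + length ([] :: item list) + length Ss div t)
      \<le> R * real (0 + q) + real (card ({} :: nat set))"
  proof (rule game_small[where J = "[]"])
    show "length Ss div t * t \<le> length Ss" by simp
    show "length Ss div t \<le> q" using length_Ss assms t\<eta>(3)
      by (metis div_le_mono le_add2 nonzero_mult_div_cancel_left not_one_le_zero)
  qed (use assms in \<open>auto simp: valid_input_def\<close>)
  then show ?thesis by simp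
qed

lemma base_A:
  "base_packs (of_nat (t - 1) * \<eta>) ((n + 5) div 6) (replicate_mset n (sizeA, c))"
proof -
  have "base_packs (of_nat (t - 1) * \<eta>) ((length (replicate n {#(sizeA, c)#}) + 6 - 1) div 6)
      (sum_list (replicate n {#(sizeA, c)#}))"
    by (rule base_packs_units[where s = sizeA and c = c]) (use t\<eta>(4) in auto)
  moreover have "sum_list (replicate n {#(sizeA, c)#}) = replicate_mset n (sizeA, c)"
    by (induction n) auto
  ultimately show ?thesis by (simp add: add.commute)
qed

lemma valid_A: "valid_input (replicate n (sizeA, c))"
  by (simp add: valid_input_def)

lemma blocked_A:
  assumes "valid_input (T @ J)" "1 \<le> number isA (run A (T @ J)) b"
  shows "blocked t (run A (T @ J)) b (1 - of_nat t * \<eta>, c)"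
proof -
  obtain x where x: "isA x" "(x, b) \<in> set (run A (T @ J))"
    using assms(2) number_pos[of isA "run A (T @ J)" b] by (auto simp: Suc_le_eq)
  have "0 \<le> item_size (fst z)" if "z \<in> set (run A (T @ J))" for z
    using mem_run[OF that] assms(1) unfolding valid_input_def by (meson less_imp_le)
  from load_ge_member[OF this x(2)] have "sizeA \<le> load (run A (T @ J)) b"
    using x(1) by (simp add: isA_def)
  then show ?thesis using t\<eta>(1) by (simp add: blocked_def)
qed

lemma not_isA_T: "x \<in> set T \<Longrightarrow> \<not> isA x"
  using T_size(2)[of x] \<eta> by (auto simp: isA_def)

lemma number_isA_T: "number isA (run A T) b = 0"
  unfolding number_def using not_isA_T mem_run by (auto simp: filter_empty_conv)

lemma full_color:
  assumes "b \<in> full"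
  shows "b \<in> bins (run A T)" "t \<le> card (colors (run A T) b)"
  using assms by (auto simp: full_def)

lemma bins_mono: "bins (run A I) \<subseteq> bins (run A (I @ J))"
  by (metis bins_append run_appendE Un_upper1)

section \<open>Two colors per bin\<close>


text \<open>The tiny items use the colors below \<open>N\<close>, so \<open>N\<close> is a fresh
  color. The factor 36 makes the number of optimal bins whole in every ending. The inequalities of
  the endings form an infeasible linear system.\<close>

lemma two_colors:
  assumes t2: "t = 2" and N: "N = 36 * m" and m: "1000 \<le> m" and R: "R = 1717668486 / 1000000000"
    and \<eta>m: "8 * \<eta> * 4 ^ (2 ^ (36 * m)) \<le> 1 / 1000"
  shows False
proof -
  define J where "J = replicate (36 * m) (sizeA, N)"
  have vTJ: "valid_input (T @ J)" using valid_T valid_A by (simp add: J_def valid_input_append)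
  obtain ws where ws: "run A (T @ J) = run A T @ ws" "map fst ws = J" by (rule run_appendE)
  define K0 where "K0 = {b \<in> bins (run A (T @ J)) - full. 1 \<le> number isA (run A (T @ J)) b}"
  define E where "E = excess J full"
  have full: "b \<in> bins (run A (T @ J))" "N \<notin> colors (run A (T @ J)) b"
    "t \<le> card (colors (run A (T @ J)) b)" "colors (run A (T @ J)) b = colors (run A T) b" if "b \<in> full" for b
  proof -
    show *: "colors (run A (T @ J)) b = colors (run A T) b" using full_bin[OF vTJ] full_color[OF that] by simp
    show "b \<in> bins (run A (T @ J))" using full_color[OF that] bins_mono by blast
    show "N \<notin> colors (run A (T @ J)) b" "t \<le> card (colors (run A (T @ J)) b)"
      unfolding * using full_color[OF that] colors_T_less by blast+
  qed
  have wsA: "item_color (fst z) = N" "isA (fst z)" if "z \<in> set ws" for z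
  proof -
    have "fst z \<in> set J" using that ws(2) by force
    then show "item_color (fst z) = N" "isA (fst z)" by (auto simp: J_def isA_def)
  qed
  have fin: "finite K0" by (simp add: K0_def)
  have numA: "number isA (run A (T @ J)) b = number isA ws b" for b
    by (simp add: ws(1) number_append number_isA_T)
  have "bins ws \<subseteq> K0"
  proof
    fix b assume "b \<in> bins ws"
    then obtain z where z: "z \<in> set ws" "snd z = b" by (auto simp: bins_def)
    have "N \<in> colors ws b" unfolding colors_def
      by (rule image_eqI[of _ _ z]) (use z wsA(1)[OF z(1)] in simp_all)
    then have "N \<in> colors (run A (T @ J)) b" by (simp add: ws(1) colors_append)
    then have "b \<notin> full" using full(2) by blast
    moreover have "0 < number isA ws b" unfolding number_pos
      by (rule exI[of _ "fst z"]) (use z wsA(2)[OF z(1)] in auto)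
    moreover have "b \<in> bins (run A (T @ J))" using \<open>b \<in> bins ws\<close> by (simp add: ws(1) bins_append)
    ultimately show "b \<in> K0" by (simp add: K0_def numA)
  qed
  then have "(\<Sum>b\<in>K0. number isA ws b) = length J"
    by (intro sum_number_all[OF _ fin ws(2)]) (simp_all add: J_def isA_def)
  then have sumA: "(\<Sum>b\<in>K0. number isA (run A (T @ J)) b) = 36 * m"
    unfolding numA by (simp add: J_def)
  have Eeq: "E = (\<Sum>b\<in>K0. number isA (run A (T @ J)) b - 2)"
    unfolding E_def excess_def K0_def ..
  have E: "36 * m \<le> E + 2 * card K0"
    using sum_monus[OF fin, of "number isA (run A (T @ J))"] sumA by (simp add: Eeq)
  \<comment> \<open>The ending after the items of size about 1/7: their \<open>6 * m\<close> optimal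
    bins take one tiny item each, and \<open>15 * m\<close> pairs of tiny items remain.\<close>
  have "real (card (full \<union> K0) + length (take h Os)) \<le> R * real ((36 * m + 5) div 6 + 15 * m)"
    if h: "h \<le> 15 * m" for h
  proof (rule game_open[where J = J])
    show "valid_input J" using vTJ by (simp add: valid_input_append)
    show "base_packs (of_nat (t - 1) * \<eta>) ((36 * m + 5) div 6) (mset J)"
      using base_A[of "36 * m" N] by (simp add: J_def)
    show "full \<union> K0 \<subseteq> bins (run A (T @ J))" using full(1) by (auto simp: K0_def)
    show "blocked t (run A (T @ J)) z (1 - of_nat t * \<eta>, item_color x)"
      if "x \<in> set (take h Os)" "z \<in> full \<union> K0" for x z
    proof (cases "z \<in> full")
      case True
      have "x \<in> set Os" using that(1) by (rule in_set_takeD)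
      then show ?thesis using Os_color[OF _ True] full[OF True] by (simp add: blocked_def)
    next
      case False
      then show ?thesis using that by (intro blocked_A[OF vTJ]) (simp add: K0_def)
    qed
  qed (use Os_sub h N t2 in auto)
  moreover have "(36 * m + 5) div 6 = 6 * m" by simp
  moreover have "card (full \<union> K0) = card full + card K0"
    by (rule card_Un_disjoint) (use fin in \<open>auto simp: K0_def full_def\<close>)
  ultimately have S7: "real (card full + card K0 + min h (length Os)) \<le> R * real (21 * m)"
    if "h \<le> 15 * m" for h using that by (simp add: min.commute)
  have "\<exists>k yC yD P. endgame_state J full 0 (36 * m) k yC yD P"
  proof (rule endgame[where \<kappa> = N and X = "{#}"])
    show "item_size x = sizeA" if "x \<in> set J" for x using that by (simp add: J_def)
    show "full \<subseteq> bins (run A (T @ J))" using full(1) by blast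
    show "N \<notin> colors (run A (T @ J)) b" "t \<le> card (colors (run A (T @ J)) b)" if "b \<in> full" for b
      by (rule full(2)[OF that], rule full(3)[OF that])
    show "mset J = {#} + replicate_mset (36 * m) (sizeA, N)" by (simp add: J_def)
    show "N \<le> (t - 1) * (0 + 36 * m)" using N t2 by simp
  qed (rule \<eta>m base_packs_0 | simp)+
  then obtain k yC yD P where "endgame_state J full 0 (36 * m) k yC yD P" by blast
  then have eg1: "2 * yC + 2 * yD + 2 * (36 * m) + excess J full \<le> 4 * k"
    and eg2: "real (card full + k + 36 * m) \<le> R * real (36 * m) + real yC"
    and eg3: "\<forall>h q. h * t \<le> length Ss \<longrightarrow> h \<le> q \<longrightarrow> N \<le> (t - 1) * (18 * m) + t * q \<longrightarrow>
      real (card full + k + h) \<le> R * real (18 * m + q)"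
    and eg4: "\<forall>os q. mset os \<subseteq># mset T \<longrightarrow>
      (\<forall>x\<in>set os. \<forall>b\<in>full. item_color x \<notin> colors (run A (T @ J)) b) \<longrightarrow> length os \<le> q \<longrightarrow>
      N \<le> (t - 1) * (18 * m) + t * q \<longrightarrow> real (card full + k + length os) \<le> R * real (18 * m + q)"
    unfolding endgame_state_def by simp_all
  have yx: "N \<le> card (bins (run A T)) + card full" "N \<le> 2 * card (bins (run A T))"
  proof -
    have "N = (\<Sum>b\<in>bins (run A T). card (colors (run A T) b))" by (rule sum_colors_T[symmetric])
    also have "\<dots> \<le> (\<Sum>b\<in>bins (run A T). 1 + (if b \<in> full then 1 else 0))"
    proof (rule sum_mono)
      fix b assume "b \<in> bins (run A T)"
      then show "card (colors (run A T) b) \<le> 1 + (if b \<in> full then 1 else 0)"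
        unfolding full_def using colors_T_card(2)[of b] t2 by auto
    qed
    also have "\<dots> = card (bins (run A T)) + card (bins (run A T) \<inter> full)"
      unfolding sum.distrib by (simp add: sum.If_cases)
    also have "bins (run A T) \<inter> full = full" by (auto simp: full_def)
    finally show 1: "N \<le> card (bins (run A T)) + card full" .
    have "card full \<le> card (bins (run A T))" by (rule card_mono) (auto simp: full_def)
    then show "N \<le> 2 * card (bins (run A T))" using 1 by linarith
  qed
  have S0: "real (card (bins (run A T)) + length Ss div 2) \<le> R * real (18 * m)"
    using stage0[of "18 * m"] t2 N by simp
  define x where "x = card full"
  note 1 = length_Ss length_Os yx N
  \<comment> \<open>The \<open>18 * m\<close> optimal bins of the endgame take one tiny item each,
    which leaves \<open>9 * m\<close> pairs.\<close>
  have S3: "real (x + k + length Ss div 2) \<le> R * real (18 * m + 9 * m)"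
    using eg3[rule_format, of "length Ss div 2" "9 * m"] 1 t2 by (simp add: x_def)
  have S3': "real (x + k + 9 * m) \<le> R * real (18 * m + 9 * m)" if "9 * m \<le> length Os"
  proof -
    have "real (card full + k + length (take (9 * m) Os)) \<le> R * real (18 * m + 9 * m)"
    proof (rule eg4[rule_format, OF Os_sub])
      show "item_color x \<notin> colors (run A (T @ J)) b" if "x \<in> set (take (9 * m) Os)" "b \<in> full" for x b
        using Os_color[OF in_set_takeD[OF that(1)] that(2)] full(4)[OF that(2)] by simp
    qed (use N t2 in auto)
    then show ?thesis using that by (simp add: x_def)
  qed
  define s where "s = length Ss"
  have "s \<le> 2 * (s div 2) + 1" by presburger
  then have "real s \<le> real (2 * (s div 2) + 1)" by (rule of_nat_mono)
  then have s2: "(real s - 1) / 2 \<le> real (s div 2)" by simp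
  have r0: "real s + real (card (bins (run A T))) = 36 * real m"
    using length_Ss N by (simp add: s_def flip: of_nat_add)
  have r1: "36 * real m \<le> real (card (bins (run A T))) + real x" using yx(1) N unfolding x_def by linarith
  have r2: "real (length Os) + 2 * real x = 36 * real m" using length_Os unfolding x_def N t2 by linarith
  have r3: "36 * real m \<le> real E + 2 * real (card K0)" using E by linarith
  have r4: "2 * real yC + 72 * real m + real E \<le> 4 * real k" using eg1 unfolding E_def by linarith
  have r5: "real x + real k + 36 * real m \<le> R * (36 * real m) + real yC" using eg2 by (simp add: x_def)
  have r6: "real (card (bins (run A T))) + real (s div 2) \<le> R * (18 * real m)" using S0 by (simp add: s_def)
  have r7: "real x + real (card K0) + real (min (15 * m) (length Os)) \<le> R * (21 * real m)"
    using S7[of "15 * m"] by (simp add: x_def)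
  have r8: "real x + real k + real (s div 2) \<le> R * (27 * real m)" using S3 by (simp add: s_def)
  have mm: "1000 \<le> real m" using m by simp
  \<comment> \<open>\<open>length Os\<close> limits the huge items of the open kind: at most
    \<open>15 * m\<close> after the items of size about 1/7 and \<open>9 * m\<close> in the endgame.
    Below \<open>9 * m\<close>, the endgame uses the huge items for \<open>Ss\<close> instead. The
    size of \<open>m\<close> absorbs rounding.\<close>
  consider "15 * m \<le> length Os" | "9 * m \<le> length Os" "length Os < 15 * m" | "length Os < 9 * m" by linarith
  then show False
  proof cases
    case 1
    then have "real x + real k + 9 * real m \<le> R * (27 * real m)" using S3' by simp
    moreover have "real x + real (card K0) + 15 * real m \<le> R * (21 * real m)" using r7 1 by simp
    ultimately show ?thesis using r0 r1 r3 r4 r5 r6 s2 mm unfolding R by linarith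
  next
    case 2
    then have "real x + real k + 9 * real m \<le> R * (27 * real m)" using S3' by simp
    moreover have "real x + real (card K0) + real (length Os) \<le> R * (21 * real m)" using r7 2 by simp
    moreover have "real (length Os) \<le> 15 * real m" using 2 by simp
    ultimately show ?thesis using r0 r1 r2 r3 r4 r5 r6 s2 mm unfolding R by linarith
  next
    case 3
    then have "real x + real (card K0) + real (length Os) \<le> R * (21 * real m)" using r7 by simp
    moreover have "real (length Os) \<le> 9 * real m" using 3 by simp
    ultimately show ?thesis using r0 r1 r2 r3 r4 r5 r6 r8 s2 mm unfolding R by linarith
  qed
qed

section \<open>Three colors per bin\<close>


text \<open>
  With \<open>\<rho> = 2 (R + 2) / 9\<close>, the inequality for items of size about \<open>2/3\<close> is added to \<open>\<rho>\<close> times the one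
  for items of size about \<open>1/2\<close>, \<open>\<rho> / 2\<close> times the second and \<open>1 - \<rho>\<close> times the third inequality of
  the definition of \<open>endgame_state\<close>.
\<close>

lemma endgame_bound:
  assumes eg: "endgame_state J dead l n k yC yD P"
    and t3: "t = 3" and N: "N = 72 * m" and s: "36 * m \<le> length Ss" and R: "R = 180814287 / 100000000"
    and n: "even n" "36 * m \<le> 2 * l + n" "l + n \<le> 36 * m"
  shows "830814287 / 450000000 * real (card dead) + 830814287 / 450000000 * real n
      + 380814287 / 900000000 * real (excess J dead)
    \<le> 80814287 / 100000000 * (24 * real m) + 5
      + 380814287 / 300000000 * real l + 380814287 / 600000000 * real n
      + 22952221261106123 / 15000000000000000 * real l + 22952221261106123 / 15000000000000000 * real n"
proof -
  define d where "d = l + P + (n - P + 1) div 2 + (P + 5) div 6"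
  \<comment> \<open>The number of complete triples of tiny items left over when each of the
    \<open>d\<close> bins has taken two.\<close>
  define h where "h = (72 * m - 2 * d) div 3"
  have P: "2 * P \<le> n" and e1: "2 * yC + 2 * yD + 2 * n + excess J dead \<le> 4 * k" and e2: "yD + n \<le> k + P"
    and eC: "real (card dead + k + n) \<le> R * real (l + n) + real yC"
    and eD: "\<And>h q. h * t \<le> length Ss \<Longrightarrow> h \<le> q \<Longrightarrow> N \<le> (t - 1) * d + t * q \<Longrightarrow>
      real (card dead + k + P + h) \<le> R * real (d + q) + real yD"
    using eg unfolding endgame_state_def d_def by blast+
  obtain v where v: "n = P + v" using P le_Suc_ex[of P n] by auto
  define u w where "u = (v + 1) div 2" and "w = (P + 5) div 6"
  have d: "d = l + P + u + w" by (simp add: d_def u_def w_def v)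
  have d1: "v \<le> 2 * u" "2 * u \<le> v + 1" "6 * w \<le> P + 5"
    unfolding u_def w_def by presburger+
  \<comment> \<open>Hence at most \<open>36 * m\<close> tiny items are left over, and
    \<open>Ss\<close> suffices for \<open>h\<close> triples.\<close>
  have d2: "18 * m \<le> d" using d1(1) n(2) P unfolding d v by linarith
  have d3: "6 * d \<le> 6 * l + 3 * n + 4 * P + 8" using d1(2,3) unfolding d v add_mult_distrib2 by linarith
  have d4: "d \<le> 36 * m + 2" using d3 P n(3) by linarith
  have h1: "3 * h + 2 * d \<le> 72 * m \<or> h = 0" "72 * m \<le> 3 * h + 2 * d + 2" unfolding h_def by presburger+
  \<comment> \<open>One bin more than \<open>h\<close> accounts for an incomplete triple.\<close>
  have "real (card dead + k + P + h) \<le> R * real (d + (h + 1)) + real yD"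
  proof (rule eD)
    show "h * t \<le> length Ss" using h1(1) d2 s t3 by auto
  qed (use h1(2) N t3 in auto)
  then have D: "real (card dead) + real k + real P + real h
      \<le> 180814287 / 100000000 * real d + 180814287 / 100000000 * real h + 180814287 / 100000000 + real yD"
    unfolding R by (simp add: algebra_simps add_divide_distrib)
  have C: "real (card dead) + real k + real n \<le> 180814287 / 100000000 * real l + 180814287 / 100000000 * real n + real yC"
    using eC unfolding R by (simp add: algebra_simps add_divide_distrib)
  have h2: "3 * h + 2 * d \<le> 72 * m + 4" using h1(1) d4 by linarith
  have "3 * real h + 2 * real d \<le> 72 * real m + 4" using h2 by linarith
  moreover have "6 * real d \<le> 6 * real l + 3 * real n + 4 * real P + 8" using d3 by linarith
  moreover have "2 * real yC + 2 * real yD + 2 * real n + real (excess J dead) \<le> 4 * real k"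
    using e1 by linarith
  moreover have "real yD + real n \<le> real k + real P" using e2 by linarith
  \<comment> \<open>The constants are \<open>1 + \<rho>\<close>, \<open>\<rho> / 2\<close>,
    \<open>R - 1\<close>, \<open>(R + 2) / 3\<close>, \<open>(R + 2) / 6\<close> and
    \<open>\<rho> * R\<close>. After \<open>h\<close> and \<open>d\<close> are eliminated, \<rho> is
    the coefficient of \<open>P\<close> on the right of \<open>D\<close>; with this choice
    \<open>P\<close>, \<open>k\<close>, \<open>yC\<close> and \<open>yD\<close> all cancel.\<close>
  ultimately show ?thesis using C D by linarith
qed

text \<open>The adversary plays the endgame with the fresh color \<open>N\<close>, or first gives
  \<open>30 * m\<close> items of size about 1/7 in the fresh color \<open>Suc N\<close> and
  continues with that. Either way \<open>36 * m\<close> optimal bins with two tiny items each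
  suffice when items of size about 1/2 come last.\<close>

lemma three_colors:
  assumes t3: "t = 3" and N: "N = 72 * m" and m: "100000 \<le> m" and R: "R = 180814287 / 100000000"
    and \<eta>m: "8 * \<eta> * 4 ^ (2 ^ (36 * m)) \<le> 1 / 1000"
  shows False
proof -
  define J1 J2 where "J1 = replicate (36 * m) (sizeA, N)" and "J2 = J1 @ replicate (30 * m) (sizeA, Suc N)"
  have v1: "valid_input (T @ J1)" and v2: "valid_input (T @ J2)" and v12: "valid_input J1" "valid_input J2"
    using valid_T valid_A by (simp_all add: J1_def J2_def valid_input_append)
  obtain ws1 where ws1: "run A (T @ J1) = run A T @ ws1" "map fst ws1 = J1" by (rule run_appendE)
  obtain ws2 where ws2: "run A ((T @ J1) @ replicate (30 * m) (sizeA, Suc N)) = run A (T @ J1) @ ws2"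
    "map fst ws2 = replicate (30 * m) (sizeA, Suc N)" by (rule run_appendE)
  have r2: "run A (T @ J2) = run A (T @ J1) @ ws2" using ws2(1) by (simp add: J2_def)
  define dead where "dead = {b \<in> bins (run A (T @ J1)). card (colors (run A (T @ J1)) b) = 3}"
  define a1 where "a1 = number isA (run A (T @ J1))"
  define a2 where "a2 = number isA (run A (T @ J2))"
  have a1: "a1 b = number isA ws1 b" for b by (simp add: a1_def ws1(1) number_append number_isA_T)
  have a2: "a2 b = a1 b + number isA ws2 b" for b by (simp add: a2_def a1_def r2 number_append)
  have full_iff: "b \<in> full \<longleftrightarrow> b \<in> bins (run A T) \<and> card (colors (run A T) b) = 3" for b
    unfolding full_def using t3 by simp
  have pos: "0 < number isA ws b \<and> c \<in> colors ws b"
    if b: "b \<in> bins ws" and r: "map fst ws = replicate i (sizeA, c)" for ws b i c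
  proof -
    obtain z where z: "z \<in> set ws" "snd z = b" using b by (auto simp: bins_def)
    have "fst z \<in> set (map fst ws)" using z by simp
    then have f: "fst z = (sizeA, c)" unfolding r by simp
    have "c \<in> colors ws b" unfolding colors_def by (rule image_eqI[of _ _ z]) (use z f in simp_all)
    moreover have "0 < number isA ws b" unfolding number_pos
    proof (intro exI conjI)
      show "isA (sizeA, c)" by (simp add: isA_def)
      have "z = ((sizeA, c), b)" using z(2) f by (metis prod.collapse)
      then show "((sizeA, c), b) \<in> set ws" using z(1) by simp
    qed
    ultimately show ?thesis by simp
  qed
  have pos1: "0 < a1 b" "N \<in> colors ws1 b" if "b \<in> bins ws1" for b
    using pos[OF that ws1(2)[unfolded J1_def]] a1 by simp_all
  have pos2: "0 < a2 b" "Suc N \<in> colors ws2 b" if "b \<in> bins ws2" for b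
    using pos[OF that ws2(2)] a2 by simp_all
  have a1_bins: "b \<in> bins ws1" if "0 < a1 b" for b
    using that unfolding a1 number_pos by (force simp: bins_def)
  have full: "b \<in> bins (run A (T @ J1))" "N \<notin> colors (run A (T @ J1)) b" "b \<in> dead" "b \<notin> bins ws1"
    "t \<le> card (colors (run A (T @ J1)) b)"
    "colors (run A (T @ J1)) b = colors (run A T) b" "colors (run A (T @ J2)) b = colors (run A T) b" if "b \<in> full" for b
  proof -
    show *: "colors (run A (T @ J1)) b = colors (run A T) b" "colors (run A (T @ J2)) b = colors (run A T) b"
      using full_bin[OF v1] full_bin[OF v2] full_color[OF that] by simp_all
    show 1: "b \<in> bins (run A (T @ J1))" using full_color[OF that] bins_mono by blast
    show 2: "N \<notin> colors (run A (T @ J1)) b" and "t \<le> card (colors (run A (T @ J1)) b)"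
      unfolding * using full_color[OF that] colors_T_less by blast+
    have "card (colors (run A T) b) = t" using that by (simp add: full_def)
    then show "b \<in> dead" unfolding dead_def using 1 * t3 by simp
    show "b \<notin> bins ws1" using pos1(2)[of b] 2 by (auto simp: ws1(1) colors_append)
  qed
  have c1: "card (colors (run A (T @ J1)) b) \<le> 3" for b
    using run_feasible(2)[OF alg v1] t3 by simp
  have less1: "c < Suc N" if c: "c \<in> colors (run A (T @ J1)) b" for b c
  proof -
    obtain z where z: "z \<in> set (run A (T @ J1))" "c = item_color (fst z)"
      using c by (auto simp: colors_def)
    have "fst z \<in> set T \<or> fst z \<in> set J1" using mem_run[OF z(1)] by simp
    then show ?thesis using color_less[of "fst z"] z(2) by (auto simp: J1_def)
  qed
  have dead: "b \<in> bins (run A (T @ J2))" "Suc N \<notin> colors (run A (T @ J2)) b" "b \<notin> bins ws2"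
    "t \<le> card (colors (run A (T @ J2)) b)" if "b \<in> dead" for b
  proof -
    have d: "b \<in> bins (run A (T @ J1))" "t \<le> card (colors (run A (T @ J1)) b)"
      using that t3 by (auto simp: dead_def)
    have *: "colors (run A (T @ J2)) b = colors (run A (T @ J1)) b"
      using full_bin[OF _ d(2), of "replicate (30 * m) (sizeA, Suc N)"] v2 by (simp add: J2_def)
    show "b \<in> bins (run A (T @ J2))" using d(1) by (simp add: r2 bins_append)
    show 1: "Suc N \<notin> colors (run A (T @ J2)) b" and "t \<le> card (colors (run A (T @ J2)) b)"
      unfolding * using d less1 by blast+
    show "b \<notin> bins ws2" using pos2(2)[of b] 1 by (auto simp: r2 colors_append)
  qed

  \<comment> \<open>Classes of bins and their sizes\<close>
  define K1 K2 where "K1 = {b \<in> bins (run A (T @ J1)) - full. 1 \<le> a1 b}"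
    and "K2 = {b \<in> bins (run A (T @ J2)) - dead. 1 \<le> a2 b}"
  \<comment> \<open>\<open>D\<close> are the bins that color \<open>N\<close> filled up to three
    colors; bins in \<open>F\<close> contain it as well but can still take
    \<open>Suc N\<close>.\<close>
  define D F where "D = dead - full" and "F = K1 - dead"
  have fin: "finite K1" "finite K2" "finite D" "finite F" "finite dead" "finite full"
    by (simp_all add: K1_def K2_def D_def F_def dead_def full_def)
  have ws1K: "bins ws1 \<subseteq> K1"
    using full(4) pos1(1) by (auto simp: K1_def ws1(1) bins_append Suc_le_eq)
  have ws2K: "bins ws2 \<subseteq> K2"
    using dead(3) pos2(1) by (auto simp: K2_def r2 bins_append Suc_le_eq)
  have DK: "D \<subseteq> K1"
  proof
    fix b assume b: "b \<in> D"
    have "b \<in> bins ws1"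
    proof (rule ccontr)
      assume n: "b \<notin> bins ws1"
      then have "{z \<in> set ws1. snd z = b} = {}" unfolding bins_def by blast
      then have "colors ws1 b = {}" by (simp add: colors_def)
      then have "card (colors (run A T) b) = 3" "b \<in> bins (run A T)"
        using b n by (auto simp: D_def dead_def ws1(1) colors_append bins_append)
      then show False using b by (simp add: D_def full_iff)
    qed
    then show "b \<in> K1" using ws1K by blast
  qed
  have K1: "K1 = D \<union> F" "D \<inter> F = {}"
    using DK by (auto simp: D_def F_def K1_def)
  have FK2: "F \<subseteq> K2" by (auto simp: F_def K1_def K2_def r2 bins_append a2)
  have sum1: "(\<Sum>b\<in>D. a1 b) + (\<Sum>b\<in>F. a1 b) = 36 * m"
  proof -
    have "(\<Sum>b\<in>D. a1 b) + (\<Sum>b\<in>F. a1 b) = (\<Sum>b\<in>K1. a1 b)"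
      unfolding K1(1) by (rule sum.union_disjoint[symmetric]) (use fin K1(2) in auto)
    also have "\<dots> = length J1"
      unfolding a1 by (rule sum_number_all[OF ws1K fin(1) ws1(2)]) (simp add: J1_def isA_def)
    finally show ?thesis by (simp add: J1_def)
  qed
  have sum2: "30 * m + (\<Sum>b\<in>F. a1 b) \<le> (\<Sum>b\<in>K2. a2 b)"
  proof -
    have "(\<Sum>b\<in>K2. number isA ws2 b) = 30 * m"
      using sum_number_all[OF ws2K fin(2) ws2(2), of isA] by (simp add: isA_def)
    moreover have "(\<Sum>b\<in>F. a1 b) \<le> (\<Sum>b\<in>K2. a1 b)" by (rule sum_mono2) (use fin FK2 in auto)
    ultimately show ?thesis unfolding a2 sum.distrib by simp
  qed
  define E1 E2 where "E1 = excess J1 full" and "E2 = excess J2 dead"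
  have E1: "E1 = (\<Sum>b\<in>D. a1 b - 2) + (\<Sum>b\<in>F. a1 b - 2)"
  proof -
    have "E1 = (\<Sum>b\<in>K1. a1 b - 2)" unfolding E1_def excess_def K1_def a1_def ..
    then show ?thesis unfolding K1(1) using sum.union_disjoint[OF fin(3,4) K1(2)] by simp
  qed
  have E2: "E2 = (\<Sum>b\<in>K2. a2 b - 2)" unfolding E2_def excess_def K2_def a2_def ..
  define x kd kf af kw y cA s where "x = card full" and "kd = card D" and "kf = card F"
    and "af = (\<Sum>b\<in>F. a1 b)" and "kw = card K2" and "y = card (bins (run A T))"
    and "cA = card (bins (run A (T @ J1)))" and "s = length Ss"
  \<comment> \<open>At most two items per bin are missing from the excess. On \<open>F\<close> the
    whole number \<open>af\<close> is kept, because these items count again towards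
    \<open>E2\<close>.\<close>
  have q1: "36 * m \<le> E1 + af + 2 * kd"
    using sum_monus[OF fin(3), of a1] sum1 E1 by (simp add: af_def kd_def)
  have q2: "36 * m \<le> E1 + 2 * kd + 2 * kf"
    using sum_monus[OF fin(3), of a1] sum_monus[OF fin(4), of a1] sum1 E1 by (simp add: kf_def kd_def)
  have q3: "30 * m + af \<le> E2 + 2 * kw"
    using sum_monus[OF fin(2), of a2] sum2 E2 by (simp add: kw_def af_def)
  have cd: "card dead = x + kd"
  proof -
    have "full \<subseteq> dead" using full(3) by blast
    then have "card D = card dead - card full" "card full \<le> card dead"
      unfolding D_def using fin by (simp_all add: card_Diff_subset card_mono)
    then show ?thesis by (simp add: x_def kd_def)
  qed
  define O1 where "O1 = {b \<in> bins (run A T). card (colors (run A T) b) = 1}"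
  \<comment> \<open>A bin of \<open>F\<close> is new or had a single tiny item: with two of them,
    \<open>N\<close> would be the third color.\<close>
  have q4: "kf + y \<le> cA + card O1"
  proof -
    have sub: "F \<subseteq> (bins (run A (T @ J1)) - bins (run A T)) \<union> O1"
    proof
      fix b assume b: "b \<in> F"
      then have b1: "b \<in> bins (run A (T @ J1))" "b \<notin> dead" "b \<in> bins ws1"
        using a1_bins by (auto simp: F_def K1_def Suc_le_eq)
      show "b \<in> (bins (run A (T @ J1)) - bins (run A T)) \<union> O1"
      proof (cases "b \<in> bins (run A T)")
        case True
        have "insert N (colors (run A T) b) \<subseteq> colors (run A (T @ J1)) b"
          using pos1(2)[OF b1(3)] by (simp add: ws1(1) colors_append)
        then have "card (insert N (colors (run A T) b)) \<le> card (colors (run A (T @ J1)) b)"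
          by (intro card_mono) auto
        moreover have "N \<notin> colors (run A T) b" using colors_T_less by blast
        ultimately have "Suc (card (colors (run A T) b)) \<le> card (colors (run A (T @ J1)) b)" by simp
        moreover have "card (colors (run A (T @ J1)) b) \<noteq> 3" using b1 by (simp add: dead_def)
        ultimately have "card (colors (run A T) b) = 1"
          using colors_T_card(1)[OF True] c1[of b] by linarith
        then show ?thesis using True by (simp add: O1_def)
      qed (use b1 in simp)
    qed
    have "kf \<le> card (bins (run A (T @ J1)) - bins (run A T)) + card O1"
      unfolding kf_def by (rule order.trans[OF card_mono[OF _ sub] card_Un_le]) (simp add: O1_def)
    moreover have "card (bins (run A (T @ J1)) - bins (run A T)) = cA - y"
      unfolding cA_def y_def by (rule card_Diff_subset) (simp_all add: bins_mono)
    moreover have "y \<le> cA" unfolding cA_def y_def by (rule card_mono) (simp_all add: bins_mono)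
    ultimately show ?thesis by linarith
  qed
  \<comment> \<open>A bin with one, two or three colors contributes 2, 2 or 3 to either
    side.\<close>
  have q5: "72 * m + card O1 = 2 * y + x"
  proof -
    have "72 * m + card O1 = (\<Sum>b\<in>bins (run A T). card (colors (run A T) b) + (if b \<in> O1 then 1 else 0))"
      unfolding sum.distrib sum_colors_T using N
      by (simp add: sum.If_cases O1_def Int_def conj_commute)
    also have "\<dots> = (\<Sum>b\<in>bins (run A T). 2 + (if b \<in> full then 1 else 0))"
    proof (rule sum.cong)
      fix b assume "b \<in> bins (run A T)"
      then show "card (colors (run A T) b) + (if b \<in> O1 then 1 else 0) = 2 + (if b \<in> full then 1 else 0)"
        unfolding full_iff O1_def using colors_T_card[of b] t3 by auto
    qed simp
    also have "\<dots> = 2 * y + x"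
      unfolding sum.distrib y_def x_def by (simp add: sum.If_cases full_def Int_def conj_commute)
    finally show ?thesis .
  qed
  have q6: "y + s = 72 * m" using length_Ss N by (simp add: y_def s_def)

  \<comment> \<open>Endings before the endgames\<close>
  have S0: "real (y + s div 3) \<le> R * real (24 * m)"
    using stage0[of "24 * m"] t3 N by (simp add: y_def s_def)
  have "s \<le> 3 * (s div 3) + 2" by presburger
  then have "real s \<le> real (3 * (s div 3) + 2)" by (rule of_nat_mono)
  then have sd: "real s - 2 \<le> 3 * real (s div 3)" by simp
  have ys: "real y + real s = 72 * real m" using q6 by (simp flip: of_nat_add)
  have mm: "100000 \<le> real m" using m by simp
  have S0': "real y + real (s div 3) \<le> 180814287 / 100000000 * (24 * real m)" using S0 R by simp
  have y36: "real y \<le> 36 * real m" "36 * real m \<le> real s" using S0' sd ys mm by linarith+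
  then have s36: "36 * m \<le> s" by linarith
  have div6: "(36 * m + 5) div 6 = 6 * m" "(30 * m + 5) div 6 = 5 * m" by simp_all
  have base1: "base_packs (of_nat (t - 1) * \<eta>) (6 * m) (mset J1)"
    using base_A[of "36 * m" N] unfolding div6 by (simp add: J1_def)
  have base2: "base_packs (of_nat (t - 1) * \<eta>) (6 * m + 5 * m) (mset J2)"
    using base_packs_add[OF base1 base_A[of "30 * m" "Suc N"]] unfolding div6 by (simp add: J2_def)
  have Sa: "real (cA + s div 3) \<le> R * real (26 * m)"
  proof -
    have "real (card (bins (run A (T @ J1))) + length ([] :: item list) + s div 3)
        \<le> R * real (6 * m + 20 * m) + real (card ({} :: nat set))"
    proof (rule game_small)
      show "valid_input (J1 @ [])" using v12 by simp
      show "base_packs (of_nat (t - 1) * \<eta>) (6 * m) (mset (J1 @ []))" using base1 by simp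
      show "s div 3 * t \<le> length Ss" using t3 by (simp add: s_def)
      have "s \<le> 72 * m" "24 * m \<le> y"
      proof -
        show "s \<le> 72 * m" using q6 by simp
        have "card O1 \<le> y" unfolding O1_def y_def by (rule card_mono) auto
        moreover have "x \<le> y" unfolding x_def y_def full_def by (rule card_mono) auto
        ultimately show "24 * m \<le> y" using q5 by linarith
      qed
      then show "s div 3 \<le> 20 * m" using q6 by linarith
      show "N \<le> (t - 1) * (6 * m) + t * (20 * m)" using N t3 by simp
      show "\<theta> < item_size z" if "z \<in> set J1" for z using that \<theta> \<eta> by (simp add: J1_def)
    qed auto
    then show ?thesis by (simp add: cA_def)
  qed
  \<comment> \<open>The \<open>11 * m\<close> bins with items of size about 1/7 take
    \<open>22 * m\<close> tiny items. The other \<open>50 * m\<close> form triples, and the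
    additional 1 rounds up.\<close>
  have W7: "real (card dead + kw + min (50 * m div 3) (length Os)) \<le> R * real (11 * m + (50 * m div 3 + 1))"
  proof -
    have "real (card (dead \<union> K2) + length (take (50 * m div 3) Os)) \<le> R * real (6 * m + 5 * m + (50 * m div 3 + 1))"
    proof (rule game_open[OF v12(2) base2 Os_sub])
      show "dead \<union> K2 \<subseteq> bins (run A (T @ J2))" using dead(1) by (auto simp: K2_def)
      show "N \<le> (t - 1) * (6 * m + 5 * m) + t * (50 * m div 3 + 1)" using N t3 by presburger
      show "blocked t (run A (T @ J2)) z (1 - of_nat t * \<eta>, item_color u)"
        if "u \<in> set (take (50 * m div 3) Os)" "z \<in> dead \<union> K2" for u z
      proof (cases "z \<in> full")
        case True
        have "u \<in> set Os" using that(1) by (rule in_set_takeD)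
        then show ?thesis using Os_color[OF _ True] full(7)[OF True] full_color(2)[OF True]
          by (simp add: blocked_def)
      next
        case False
        \<comment> \<open>A dead bin that was not full after the tiny items contains an item of size
          about 1/7, so its load refuses the huge item.\<close>
        then have "z \<in> D \<or> z \<in> K2" using that(2) by (auto simp: D_def)
        then have "1 \<le> a2 z" using DK by (auto simp: K1_def K2_def a2)
        then show ?thesis unfolding a2_def by (rule blocked_A[OF v2])
      qed
    qed simp
    moreover have "card (dead \<union> K2) = card dead + kw"
      unfolding kw_def by (rule card_Un_disjoint) (use fin in \<open>auto simp: K2_def\<close>)
    ultimately show ?thesis by (simp add: min.commute add.assoc)
  qed

  \<comment> \<open>Endgames with the first and with the second color\<close>
  have "\<exists>k yC yD P. endgame_state J1 full 0 (36 * m) k yC yD P"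
  proof (rule endgame[where \<kappa> = N and X = "{#}"])
    show "item_size x = sizeA" if "x \<in> set J1" for x using that by (simp add: J1_def)
    show "full \<subseteq> bins (run A (T @ J1))" using full(1) by blast
    show "N \<notin> colors (run A (T @ J1)) b" "t \<le> card (colors (run A (T @ J1)) b)" if "b \<in> full" for b
      by (rule full(2)[OF that], rule full(5)[OF that])
    show "mset J1 = {#} + replicate_mset (36 * m) (sizeA, N)" by (simp add: J1_def)
    show "N \<le> (t - 1) * (0 + 36 * m)" using N t3 by simp
  qed (rule \<eta>m base_packs_0 | simp)+
  then obtain k yC yD P where "endgame_state J1 full 0 (36 * m) k yC yD P" by blast
  from endgame_bound[OF this t3 N _ R] s36
  have B1: "830814287 / 450000000 * real x + 830814287 / 450000000 * (36 * real m) + 380814287 / 900000000 * real E1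
    \<le> 80814287 / 100000000 * (24 * real m) + 5 + 380814287 / 600000000 * (36 * real m)
      + 22952221261106123 / 15000000000000000 * (36 * real m)"
    by (simp add: s_def x_def E1_def)
  have "\<exists>k yC yD P. endgame_state J2 dead (6 * m) (30 * m) k yC yD P"
  proof (rule endgame[where \<kappa> = "Suc N" and X = "replicate_mset (36 * m) (sizeA, N)"])
    show "item_size x = sizeA" if "x \<in> set J2" for x using that by (auto simp: J1_def J2_def)
    show "dead \<subseteq> bins (run A (T @ J2))" using dead(1) by blast
    show "Suc N \<notin> colors (run A (T @ J2)) b" "t \<le> card (colors (run A (T @ J2)) b)" if "b \<in> dead" for b
      by (rule dead(2)[OF that], rule dead(4)[OF that])
    show "mset J2 = replicate_mset (36 * m) (sizeA, N) + replicate_mset (30 * m) (sizeA, Suc N)"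
      by (simp add: J1_def J2_def)
    show "base_packs (of_nat (t - 1) * \<eta>) (6 * m) (replicate_mset (36 * m) (sizeA, N))"
      using base1 by (simp add: J1_def)
    show "N \<le> (t - 1) * (6 * m + 30 * m)" using N t3 by simp
    have "(4 :: rat) ^ 2 ^ (30 * m) \<le> 4 ^ 2 ^ (36 * m)" by (intro power_increasing) auto
    then have "8 * \<eta> * 4 ^ 2 ^ (30 * m) \<le> 8 * \<eta> * 4 ^ 2 ^ (36 * m)" using t\<eta>(2) by (intro mult_left_mono) auto
    then show "8 * \<eta> * 4 ^ 2 ^ (30 * m) \<le> 1 / 1000" using \<eta>m by linarith
  qed simp
  then obtain k' yC' yD' P' where "endgame_state J2 dead (6 * m) (30 * m) k' yC' yD' P'" by blast
  from endgame_bound[OF this t3 N _ R] s36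
  have B2: "830814287 / 450000000 * real x + 830814287 / 450000000 * real kd + 830814287 / 450000000 * (30 * real m)
      + 380814287 / 900000000 * real E2
    \<le> 80814287 / 100000000 * (24 * real m) + 5 + 380814287 / 300000000 * (6 * real m)
      + 380814287 / 600000000 * (30 * real m) + 22952221261106123 / 15000000000000000 * (6 * real m)
      + 22952221261106123 / 15000000000000000 * (30 * real m)"
    by (simp add: s_def cd E2_def distrib_left)

  \<comment> \<open>The system of linear inequalities\<close>
  define h w where "h = 50 * m div 3" and "w = length Os"
  have "50 * m \<le> 3 * h + 2" "3 * h \<le> 50 * m" unfolding h_def by presburger+
  then have hb: "50 * real m \<le> 3 * real h + 2" "3 * real h \<le> 50 * real m" by linarith+
  have p1: "36 * real m \<le> real E1 + real af + 2 * real kd" using q1 by linarith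
  have p2: "36 * real m \<le> real E1 + 2 * real kd + 2 * real kf" using q2 by linarith
  have p3: "30 * real m + real af \<le> real E2 + 2 * real kw" using q3 by linarith
  have p4: "real kf + real y \<le> real cA + real (card O1)" using q4 by linarith
  have p5: "72 * real m + real (card O1) = 2 * real y + real x" using q5 by linarith
  have p6: "real w + 3 * real x = 72 * real m" using length_Os unfolding w_def x_def N t3 by linarith
  have p7: "real cA + real (s div 3) \<le> 180814287 / 100000000 * (26 * real m)" using Sa R by simp
  have p8: "real x + real kd + real kw + real (min h w) \<le> 180814287 / 100000000 * (11 * real m) + 180814287 / 100000000 * real h + 180814287 / 100000000"
    using W7 R by (simp add: cd h_def w_def algebra_simps add_divide_distrib)
  have p9: "0 \<le> real (card O1)" by simp
  show False
  \<comment> \<open>If \<open>w\<close> is smaller, every item of \<open>Os\<close> gets a huge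
    item, and \<open>p6\<close> expresses their number by that of the full bins.\<close>
  proof (cases "h \<le> w")
    case True
    then have "real x + real kd + real kw + real h \<le> 180814287 / 100000000 * (11 * real m) + 180814287 / 100000000 * real h + 180814287 / 100000000"
      using p8 by simp
    then show ?thesis using B1 B2 hb p1 p2 p3 p4 p5 p7 p9 S0' sd ys mm by linarith
  next
    case False
    then have "real x + real kd + real kw + real w \<le> 180814287 / 100000000 * (11 * real m) + 180814287 / 100000000 * real h + 180814287 / 100000000"
      using p8 by simp
    then show ?thesis using B1 B2 hb p1 p2 p3 p4 p5 p6 p7 p9 S0' sd ys mm by linarith
  qed
qed

end

section \<open>Lower bounds on the ratio\<close>

text \<open>The bisection on the empty input, with item number \<open>i\<close> in color
  \<open>i\<close> and each code step dividing the size by 4. The \<open>n\<close> colors of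
  \<open>T\<close> make the cost bound available for every continuation.\<close>

lemma tiny_game_exists:
  assumes alg: "online_algorithm t A" and t: "t = 2 \<or> t = 3" and R: "0 \<le> R"
    and \<eta>: "0 < \<eta>" "\<eta> \<le> 1 / 8000"
    and comp: "\<And>I. valid_input I \<Longrightarrow> n \<le> card (item_color ` set I) \<Longrightarrow> real (cost A I) \<le> R * real (OPT t I)"
  shows "\<exists>\<theta> T Ls Ss. length T = n \<and> tiny_game A t R \<eta> \<theta> T Ls Ss"
proof -
  define f :: "nat \<Rightarrow> nat \<Rightarrow> item" where "f i c = (\<eta> / 4 ^ c, i)" for i c
  obtain ws Ls Ss L where ad: "run A ([] @ map fst ws) = run A [] @ ws" "length ws = n"
    "\<forall>i<n. \<exists>c \<le> 2 ^ n. fst (ws ! i) = f i c"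
    "mset (map fst ws) = mset Ls + mset Ss" "length Ls = card (bins ws)"
    "\<forall>b \<in> bins ws. \<exists>x \<in> set Ls. (x, b) \<in> set ws"
    "\<forall>x \<in> set Ls. \<exists>i<n. \<exists>c \<le> L. x = f i c"
    "\<forall>x \<in> set Ss. \<exists>i<n. \<exists>c \<le> 2 ^ n. L + 2 ^ (n - n) \<le> c \<and> x = f i c"
    using adaptive_sizes[of n n A "[]" f] by auto
  define T where "T = map fst ws"
  have run: "run A T = ws" using ad(1) by (simp add: T_def)
  have lT: "length T = n" using ad(2) by (simp add: T_def)
  \<comment> \<open>Sizes in \<open>Ls\<close> are at least \<open>\<eta> / 4 ^ L\<close> and those
    in \<open>Ss\<close> at most a quarter of that. So \<theta> is below the former and still bounds
    three of the latter, which covers both values of \<open>t\<close>.\<close>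
  define \<theta> where "\<theta> = 3 / 4 * (\<eta> / 4 ^ L)"
  have antimono: "\<eta> / 4 ^ d \<le> \<eta> / 4 ^ c" if "c \<le> d" for c d :: nat
    by (rule divide_left_mono) (use \<eta> power_increasing[OF that, of "4 :: rat"] in auto)
  have T: "\<exists>c. T ! i = f i c" if "i < n" for i
    using ad(2,3) that by (auto simp: T_def)
  have col: "map item_color T = [0..<length T]"
  proof (rule nth_equalityI)
    fix i assume "i < length (map item_color T)"
    then have i: "i < n" using lT by simp
    then obtain c where "T ! i = f i c" using T by blast
    then show "map item_color T ! i = [0..<length T] ! i" using i lT by (simp add: f_def)
  qed simp
  have size: "0 < item_size x \<and> item_size x \<le> \<eta>" if "x \<in> set T" for x
  proof -
    obtain i where "i < n" "x = T ! i" using \<open>x \<in> set T\<close> lT by (auto simp: in_set_conv_nth)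
    then obtain c where "x = f i c" using T by blast
    then show ?thesis using antimono[of 0 c] \<eta> by (simp add: f_def)
  qed
  have "tiny_game A t R \<eta> \<theta> T Ls Ss"
  proof
    show "0 < \<theta>" using \<eta> by (simp add: \<theta>_def)
    have "\<theta> \<le> \<eta> / 4 ^ L" using \<eta> by (simp add: \<theta>_def field_simps)
    also have "\<dots> \<le> \<eta>" using antimono[of 0 L] by simp
    finally show "\<theta> \<le> \<eta>" .
    show "mset T = mset Ls + mset Ss" using ad(4) by (simp add: T_def)
    show "length Ls = card (bins (run A T))" using ad(5) run by simp
    show "\<exists>x\<in>set Ls. (x, b) \<in> set (run A T)" if "b \<in> bins (run A T)" for b using ad(6) run that by simp
    show "\<theta> < item_size x" if x: "x \<in> set Ls" for x
    proof -
      obtain i c where "c \<le> L" "x = f i c" using ad(7) x by blast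
      moreover have "\<theta> < \<eta> / 4 ^ L" using \<eta> by (simp add: \<theta>_def field_simps)
      ultimately show ?thesis using antimono[of c L] by (simp add: f_def)
    qed
    show "of_nat t * item_size x \<le> \<theta>" if x: "x \<in> set Ss" for x
    proof -
      obtain i c where "L + 2 ^ (n - n) \<le> c" "x = f i c" using ad(8) x by blast
      then have "item_size x \<le> \<eta> / 4 ^ Suc L" using antimono[of "Suc L" c] by (simp add: f_def)
      moreover have "of_nat t * (\<eta> / 4 ^ Suc L) \<le> 3 * (\<eta> / 4 ^ Suc L)"
        by (rule mult_right_mono) (use t \<eta> in auto)
      moreover have "3 * (\<eta> / 4 ^ Suc L) = \<theta>" by (simp add: \<theta>_def)
      moreover have "of_nat t * item_size x \<le> of_nat t * (\<eta> / 4 ^ Suc L)"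
        by (rule mult_left_mono) (use calculation(1) in auto)
      ultimately show ?thesis by linarith
    qed
    show "real (cost A (T @ J)) \<le> R * real (OPT t (T @ J))" if J: "valid_input J" for J
    proof (rule comp)
      have "valid_input T" unfolding valid_input_def
      proof (intro ballI conjI)
        fix x assume "x \<in> set T"
        then show "0 < item_size x" "item_size x \<le> 1" using size[of x] \<eta> by linarith+
      qed
      then show "valid_input (T @ J)" using J by (simp add: valid_input_append)
      have "item_color ` set T = {0..<n}" using arg_cong[OF col, of set] lT by simp
      then have "{0..<n} \<subseteq> item_color ` set (T @ J)" by auto
      then have "card {0..<n} \<le> card (item_color ` set (T @ J))" by (rule card_mono[rotated]) simp
      then show "n \<le> card (item_color ` set (T @ J))" by simp
    qed
  qed (use assms size col in auto)
  then show ?thesis using lT by blast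
qed

text \<open>The ratio is below \<open>R\<close> for all large values of the optimum, and by
  \<open>OPT_ge_colors\<close> many colors make the optimum large.\<close>

lemma asymptotic_ratio_lessD:
  assumes "asymptotic_ratio t A < ereal R" "1 \<le> t"
  shows "\<exists>n0. \<forall>n\<ge>n0. \<forall>I. valid_input I \<longrightarrow> n \<le> card (item_color ` set I) \<longrightarrow>
    real (cost A I) \<le> R * real (OPT t I)"
proof -
  have "\<forall>\<^sub>F Q in sequentially. worst_cost t A Q / ereal (real Q) < ereal R"
    using assms(1) unfolding asymptotic_ratio_def by (rule Limsup_lessD)
  then obtain Q0 where Q0: "worst_cost t A Q / ereal (real Q) < ereal R" if "Q0 \<le> Q" for Q
    by (auto simp: eventually_sequentially)
  show ?thesis
  proof (intro exI[of _ "t * (Q0 + 1)"] allI impI)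
    fix n I assume n: "t * (Q0 + 1) \<le> n" and I: "valid_input I" "n \<le> card (item_color ` set I)"
    define Q where "Q = OPT t I"
    have "t * (Q0 + 1) \<le> t * Q" using n I OPT_ge_colors[OF I(1) assms(2)] unfolding Q_def by linarith
    then have Q: "Q0 + 1 \<le> Q" using assms(2) unfolding mult_le_cancel1 by simp
    have "ereal (real (cost A I)) \<le> worst_cost t A Q"
      unfolding worst_cost_def by (rule SUP_upper) (use I in \<open>simp add: Q_def\<close>)
    then have "ereal (real (cost A I)) / ereal (real Q) \<le> worst_cost t A Q / ereal (real Q)"
      by (rule ereal_divide_right_mono) (use Q in simp)
    also have "\<dots> < ereal R" using Q0 Q by simp
    finally have "real (cost A I) / real Q < R" using Q by simp
    then show "real (cost A I) \<le> R * real (OPT t I)" using Q by (simp add: Q_def field_simps)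
  qed
qed

lemma ratio_lower_bound:
  assumes alg: "online_algorithm t A" and t: "t = 2 \<or> t = 3" and R: "0 \<le> R" and c: "1 \<le> c"
    and game: "\<And>m \<eta> \<theta> T Ls Ss. tiny_game A t R \<eta> \<theta> T Ls Ss \<Longrightarrow> length T = c * m \<Longrightarrow>
      100000 \<le> m \<Longrightarrow> 8 * \<eta> * 4 ^ (2 ^ (36 * m)) \<le> 1 / 1000 \<Longrightarrow> False"
  shows "ereal R \<le> asymptotic_ratio t A"
proof (rule ccontr)
  assume "\<not> ereal R \<le> asymptotic_ratio t A"
  then have "asymptotic_ratio t A < ereal R" by simp
  moreover have "1 \<le> t" using t by auto
  ultimately obtain n0 where n0: "\<forall>n\<ge>n0. \<forall>I. valid_input I \<longrightarrow> n \<le> card (item_color ` set I) \<longrightarrow>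
    real (cost A I) \<le> R * real (OPT t I)"
    using asymptotic_ratio_lessD by blast
  define m where "m = n0 + 100000"
  \<comment> \<open>So small that up to \<open>36 * m\<close> bisection steps for the items of size
    about 1/3 leave differences larger than the tiny items.\<close>
  define \<eta> :: rat where "\<eta> = 1 / (8000 * 4 ^ (2 ^ (36 * m)))"
  have "(1 :: rat) \<le> 4 ^ (2 ^ (36 * m))" by (rule one_le_power) simp
  then have \<eta>: "0 < \<eta>" "\<eta> \<le> 1 / 8000" "8 * \<eta> * 4 ^ (2 ^ (36 * m)) \<le> 1 / 1000"
    by (simp_all add: \<eta>_def field_simps)
  have "n0 \<le> c * m" using c by (cases c) (simp_all add: m_def)
  then obtain \<theta> T Ls Ss where "length T = c * m" "tiny_game A t R \<eta> \<theta> T Ls Ss"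
    using tiny_game_exists[OF alg t R \<eta>(1,2), of "c * m"] n0 by blast
  then show False using game[of \<eta> \<theta> T Ls Ss m] \<eta>(3) by (simp add: m_def)
qed

theorem theorem4:
  shows "(\<forall>A. online_algorithm 2 A \<longrightarrow> asymptotic_ratio 2 A \<ge> ereal 1.717668486) \<and>
         (\<forall>A. online_algorithm 3 A \<longrightarrow> asymptotic_ratio 3 A \<ge> ereal 1.80814287)"
proof (intro conjI allI impI)
  fix A assume A: "online_algorithm 2 A"
  have "ereal (1717668486 / 1000000000) \<le> asymptotic_ratio 2 A"
  proof (rule ratio_lower_bound[where c = 36, OF A])
    fix m :: nat and \<eta> \<theta> T Ls Ss
    assume g: "tiny_game A 2 (1717668486 / 1000000000) \<eta> \<theta> T Ls Ss" and "length T = 36 * m"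
      "100000 \<le> m" "8 * \<eta> * 4 ^ (2 ^ (36 * m)) \<le> 1 / 1000"
    then show False by (intro tiny_game.two_colors[OF g, of m]) simp_all
  qed simp_all
  then show "asymptotic_ratio 2 A \<ge> ereal 1.717668486" by simp
next
  fix A assume A: "online_algorithm 3 A"
  have "ereal (180814287 / 100000000) \<le> asymptotic_ratio 3 A"
  proof (rule ratio_lower_bound[where c = 72, OF A])
    fix m :: nat and \<eta> \<theta> T Ls Ss
    assume g: "tiny_game A 3 (180814287 / 100000000) \<eta> \<theta> T Ls Ss" and "length T = 72 * m"
      "100000 \<le> m" "8 * \<eta> * 4 ^ (2 ^ (36 * m)) \<le> 1 / 1000"
    then show False by (intro tiny_game.three_colors[OF g, of m]) simp_all
  qed simp_all
  then show "asymptotic_ratio 3 A \<ge> ereal 1.80814287" by simp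
qed

end
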